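(* Let $F:\mathbb{T}^2\times[0,1]\to\mathbb{T}^2\times[0,1]$ be a $C^2$ Kan-type partially hyperbolic diffeomorphism, $F(x,t)=(Ax,\phi_x(t))$, where $A:\mathbb{T}^2\to\mathbb{T}^2$ is an Anosov toral automorphism fixing two points $p,q\in\mathbb{T}^2$ (the same points $p,q$ as in the definition of Kan-type, so that $\phi_p$ is an NS-map and $\phi_q$ is an SN-map). Assume that $$\frac{\ln\phi_p'(0)}{\ln\phi_q'(0)}\notin\mathbb{Q}.$$ Then $F$ is topologically transitive.
   Context: $\mathbb{T}^2=\mathbb{R}^2/\mathbb{Z}^2$. An Anosov toral automorphism $A$ of $\mathbb{T}^2$ is the map induced by a matrix in $GL(2,\mathbb{Z})$ with no eigenvalue of modulus $1$. For a map $\phi_x:[0,1]\to[0,1]$, $\phi_x'$ denotes the derivative with respect to $t$ (one-sided at the endpoints). Pole maps: let $\phi:[0,1]\to[0,1]$ be a diffeomorphism fixing both endpoints. It is an NS-map (north–south pole map) if $0<\phi'(0)<1<\phi'(1)$ and $\phi(t)<t$ for every $t\in(0,1)$. It is an SN-map (south–north pole map) if $0<\phi'(1)<1<\phi'(0)$ and $\phi(t)>t$ for every $t\in(0,1)$. Kan-type: let $F:\mathbb{T}^2\times[0,1]\to\mathbb{T}^2\times[0,1]$ be a $C^2$ skew-product $F(x,t)=(Ax,\phi_x(t))$, where $A$ is an Anosov toral automorphism of $\mathbb{T}^2$ fixing two points $p$ and $q$. $F$ is called a Kan-type partially hyperbolic diffeomorphism if: ($K_1$) for every $x\in\mathbb{T}^2$,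 $\phi_x(0)=0$ and $\phi_x(1)=1$; ($K_2$) $\phi_p$ is an NS-map and $\phi_q$ is an SN-map; ($K_3$) for every $(x,t)\in\mathbb{T}^2\times[0,1]$, $\|A^{-1}\|^{-1}<\phi_x'(t)<\|A\|$, i.e. $F$ is (absolutely) partially hyperbolic. Here the norm is the one adapted to $A$, so that $\|A^{-1}\|^{-1}=\lambda$ and $\|A\|=\lambda^{-1}$, where $\lambda\in(0,1)$ is the modulus of the contracting eigenvalue of $A$; thus ($K_3$) reads $\lambda<\phi_x'(t)<\lambda^{-1}$. A continuous map $F:M\to M$ is topologically transitive if for any two nonempty open sets $U,V\subseteq M$ there is a positive integer $m$ with $F^m(U)\cap V\neq\varnothing$. *)

theory Defs
  imports "HOL-Analysis.Analysis"
begin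

section \<open>The torus \<open>\<real>\<^sup>2/\<int>\<^sup>2\<close>\<close>

definition lattice_rel :: "real^2 \<Rightarrow> real^2 \<Rightarrow> bool" where
  "lattice_rel v w \<longleftrightarrow> (\<forall>i. v $ i - w $ i \<in> \<int>)"

lemma equivp_lattice_rel: "equivp lattice_rel"
proof (rule equivpI)
  show "reflp lattice_rel"
    by (auto simp: reflp_def lattice_rel_def)
  show "symp lattice_rel"
    unfolding symp_def lattice_rel_def by (metis Ints_minus minus_diff_eq)
  show "transp lattice_rel"
    unfolding transp_def lattice_rel_def
  proof (intro allI impI)
    fix u v w :: "real^2" and i
    assume "\<forall>i. u $ i - v $ i \<in> \<int>" "\<forall>i. v $ i - w $ i \<in> \<int>"
    then have "(u $ i - v $ i) + (v $ i - w $ i) \<in> \<int>"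
      by (blast intro: Ints_add)
    then show "u $ i - w $ i \<in> \<int>" by simp
  qed
qed

quotient_type torus = "real^2" / lattice_rel
  morphisms torus_rep torus_proj
  by (rule equivp_lattice_rel)

instantiation torus :: topological_space
begin

definition open_torus :: "torus set \<Rightarrow> bool" where
  "open_torus U \<longleftrightarrow> open (torus_proj -` U)"

instance
proof
  show "open (UNIV :: torus set)"
    by (simp add: open_torus_def)
  show "open (S \<inter> T)" if "open S" "open T" for S T :: "torus set"
    using that by (simp add: open_torus_def open_Int)
  show "open (\<Union>K)" if "\<forall>S\<in>K. open S" for K :: "torus set set"
    using that by (auto simp: open_torus_def vimage_Union)
qed

end

section \<open>Anosov toral automorphisms\<close>

abbreviation of_int_matrix :: "int^2^2 \<Rightarrow> 'a::ring_1^2^2" where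
  "of_int_matrix A \<equiv> map_matrix of_int A"

definition complex_eigenvalue :: "int^2^2 \<Rightarrow> complex \<Rightarrow> bool" where
  "complex_eigenvalue A \<mu> \<longleftrightarrow> (\<exists>v::complex^2. v \<noteq> 0 \<and> of_int_matrix A *v v = \<mu> *s v)"

(* invertible over the integers, i.e. an element of GL(2,Z) *)
definition anosov_matrix :: "int^2^2 \<Rightarrow> bool" where
  "anosov_matrix A \<longleftrightarrow> invertible A \<and> (\<forall>\<mu>. complex_eigenvalue A \<mu> \<longrightarrow> cmod \<mu> \<noteq> 1)"

lift_definition toral_map :: "int^2^2 \<Rightarrow> torus \<Rightarrow> torus"
  is "\<lambda>A v. of_int_matrix A *v v"
proof -
  fix A :: "int^2^2" and v w :: "real^2"
  assume vw: "lattice_rel v w"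
  show "lattice_rel (of_int_matrix A *v v) (of_int_matrix A *v w)"
    unfolding lattice_rel_def
  proof
    fix i
    have "(of_int_matrix A *v v) $ i - (of_int_matrix A *v w) $ i
        = (\<Sum>j\<in>UNIV. of_int (A $ i $ j) * (v $ j - w $ j))"
      by (simp add: matrix_vector_mult_def sum_subtractf algebra_simps)
    also have "\<dots> \<in> \<int>"
      using vw by (auto simp: lattice_rel_def intro!: Ints_sum Ints_mult)
    finally show "(of_int_matrix A *v v) $ i - (of_int_matrix A *v w) $ i \<in> \<int>" .
  qed
qed

(* In a norm adapted to A, the contraction rate is the reciprocal of the norm of the inverse of A,
   and, since det A is 1 or -1, its inverse is the norm of A.  It is well-defined for Anosov A
   by contraction_rate_unique. *)
definition contraction_rate :: "int^2^2 \<Rightarrow> real" where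
  "contraction_rate A = (THE r. r < 1 \<and> (\<exists>\<mu>. complex_eigenvalue A \<mu> \<and> cmod \<mu> = r))"

lemma complex_eigenvalue_iff:
  "complex_eigenvalue A \<mu> \<longleftrightarrow>
     \<mu>\<^sup>2 - of_int (A $ 1 $ 1 + A $ 2 $ 2) * \<mu> + of_int (det A) = 0"
proof -
  let ?M = "of_int_matrix A - mat \<mu> :: complex^2^2"
  have "of_int_matrix A *v v = \<mu> *s v \<longleftrightarrow> ?M *v v = 0" for v :: "complex^2"
    by (simp add: vec_eq_iff matrix_vector_mult_def UNIV_2 mat_def forall_2 algebra_simps)
  then have "complex_eigenvalue A \<mu> \<longleftrightarrow> \<not> invertible ?M"
    unfolding complex_eigenvalue_def
    by (metis invertible_left_inverse matrix_left_invertible_ker)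
  also have "\<dots> \<longleftrightarrow> det ?M = 0"
    by (simp add: invertible_det_nz)
  also have "det ?M = \<mu>\<^sup>2 - of_int (A $ 1 $ 1 + A $ 2 $ 2) * \<mu> + of_int (det A)"
    by (simp add: det_2 mat_def power2_eq_square algebra_simps)
  finally show ?thesis .
qed

lemma contraction_rate_unique:
  assumes "anosov_matrix A"
  shows "\<exists>!r. r < 1 \<and> (\<exists>\<mu>. complex_eigenvalue A \<mu> \<and> cmod \<mu> = r)"
proof -
  obtain B where "A ** B = mat 1"
    using assms by (auto simp: anosov_matrix_def invertible_def)
  then have "det A * det B = 1"
    by (metis det_I det_mul)
  then have "\<bar>det A\<bar> = 1"
    by (metis abs_mult abs_1 abs_zmult_eq_1)
  define t d where "t = (of_int (A $ 1 $ 1 + A $ 2 $ 2) :: complex)" and "d = (of_int (det A) :: complex)"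
  have ev_iff: "complex_eigenvalue A \<mu> \<longleftrightarrow> \<mu> * \<mu> - t * \<mu> + d = 0" for \<mu>
    by (simp only: complex_eigenvalue_iff t_def d_def power2_eq_square)
  have d: "cmod d = 1"
    using \<open>\<bar>det A\<bar> = 1\<close> by (metis d_def norm_of_int of_int_1 of_int_abs)
  obtain s where s: "s * s = t * t - 4 * d"
    by (metis power2_csqrt power2_eq_square)
  define a b where "a = (t + s) / 2" and "b = (t - s) / 2"
  have "a + b = t"
    by (simp add: a_def b_def field_simps)
  moreover have ab: "a * b = d"
    using s by (simp add: a_def b_def field_simps)
  ultimately have ev: "complex_eigenvalue A a" "complex_eigenvalue A b"
    unfolding ev_iff by (auto simp: algebra_simps)
  have "cmod a * cmod b = 1"
    by (metis d ab norm_mult)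
  moreover have "cmod a \<noteq> 1" "cmod b \<noteq> 1"
    using assms ev by (auto simp: anosov_matrix_def)
  ultimately have ex: "\<exists>\<mu>. complex_eigenvalue A \<mu> \<and> cmod \<mu> < 1"
    using ev by (smt (verit) mult_le_cancel_right1 norm_ge_zero)
  have uniq: "\<mu> = \<nu>"
    if \<mu>: "complex_eigenvalue A \<mu>" "cmod \<mu> < 1" and \<nu>: "complex_eigenvalue A \<nu>" "cmod \<nu> < 1"
    for \<mu> \<nu>
  proof (rule ccontr)
    assume ne: "\<mu> \<noteq> \<nu>"
    have e1: "\<mu> * \<mu> - t * \<mu> + d = 0" and e2: "\<nu> * \<nu> - t * \<nu> + d = 0"
      using \<mu> \<nu> by (simp_all add: ev_iff)
    have "(\<mu> - \<nu>) * (\<mu> + \<nu> - t) = (\<mu> * \<mu> - t * \<mu> + d) - (\<nu> * \<nu> - t * \<nu> + d)"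
      by (simp add: algebra_simps)
    then have "(\<mu> - \<nu>) * (\<mu> + \<nu> - t) = 0"
      unfolding e1 e2 by simp
    then have "t = \<mu> + \<nu>"
      using ne by simp
    then have "\<mu> * \<nu> = d"
      using e1 by (simp add: algebra_simps)
    then have "cmod \<mu> * cmod \<nu> = 1"
      by (metis d norm_mult)
    moreover have "cmod \<mu> * cmod \<nu> < 1 * 1"
      using \<mu> \<nu> by (intro mult_strict_mono') auto
    ultimately show False by simp
  qed
  show ?thesis
    using ex uniq by blast
qed

section \<open>Differentiability up to the boundary\<close>

(* Derivatives are taken relative to S.  For a convex S with nonempty interior, the only case
   used below, they are unique, and at boundary points they are the one-sided derivatives. *)
definition C1_on :: "'a::euclidean_space set \<Rightarrow> ('a \<Rightarrow> 'b::real_normed_vector) \<Rightarrow> bool" where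
  "C1_on S f \<longleftrightarrow> (\<exists>f' :: 'a \<Rightarrow> 'a \<Rightarrow>\<^sub>L 'b.
     (\<forall>x\<in>S. (f has_derivative blinfun_apply (f' x)) (at x within S)) \<and> continuous_on S f')"

definition C2_on :: "'a::euclidean_space set \<Rightarrow> ('a \<Rightarrow> 'b::real_normed_vector) \<Rightarrow> bool" where
  "C2_on S f \<longleftrightarrow> (\<exists>f' :: 'a \<Rightarrow> 'a \<Rightarrow>\<^sub>L 'b.
     (\<forall>x\<in>S. (f has_derivative blinfun_apply (f' x)) (at x within S)) \<and> C1_on S f')"

abbreviation fibre_deriv :: "(real \<Rightarrow> real) \<Rightarrow> real \<Rightarrow> real" where
  "fibre_deriv f t \<equiv> vector_derivative f (at t within {0..1})"

section \<open>Kan-type maps of the thickened torus\<close>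

definition interval_diffeo :: "(real \<Rightarrow> real) \<Rightarrow> bool" where
  "interval_diffeo f \<longleftrightarrow> bij_betw f {0..1} {0..1} \<and> C1_on {0..1} f
     \<and> C1_on {0..1} (inv_into {0..1} f)"

definition NS_map :: "(real \<Rightarrow> real) \<Rightarrow> bool" where
  "NS_map f \<longleftrightarrow> interval_diffeo f \<and> f 0 = 0 \<and> f 1 = 1
     \<and> 0 < fibre_deriv f 0 \<and> fibre_deriv f 0 < 1 \<and> 1 < fibre_deriv f 1
     \<and> (\<forall>t\<in>{0<..<1}. f t < t)"

definition SN_map :: "(real \<Rightarrow> real) \<Rightarrow> bool" where
  "SN_map f \<longleftrightarrow> interval_diffeo f \<and> f 0 = 0 \<and> f 1 = 1
     \<and> 0 < fibre_deriv f 1 \<and> fibre_deriv f 1 < 1 \<and> 1 < fibre_deriv f 0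
     \<and> (\<forall>t\<in>{0<..<1}. f t > t)"

definition thick_torus :: "(torus \<times> real) set" where
  "thick_torus = UNIV \<times> {0..1}"

(* Since the torus carries the smooth structure of its universal covering, a self-map of
   thick_torus is C^2 iff it has a C^2 lift to the covering space R^2 x [0,1]. *)
definition C2_thick_torus_map :: "(torus \<times> real \<Rightarrow> torus \<times> real) \<Rightarrow> bool" where
  "C2_thick_torus_map F \<longleftrightarrow> F ` thick_torus \<subseteq> thick_torus \<and>
     (\<exists>G :: (real^2) \<times> real \<Rightarrow> (real^2) \<times> real. C2_on (UNIV \<times> {0..1}) G \<and>
        (\<forall>v. \<forall>t\<in>{0..1}. F (torus_proj v, t) = (torus_proj (fst (G (v, t))), snd (G (v, t)))))"

definition kan_type ::
  "(torus \<times> real \<Rightarrow> torus \<times> real) \<Rightarrow> int^2^2 \<Rightarrow> (torus \<Rightarrow> real \<Rightarrow> real) \<Rightarrow> torus \<Rightarrow> torus \<Rightarrow> bool"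
where
  "kan_type F A \<phi> p q \<longleftrightarrow>
     anosov_matrix A \<and> p \<noteq> q \<and> toral_map A p = p \<and> toral_map A q = q
     \<and> C2_thick_torus_map F
     \<and> (\<forall>x. \<forall>t\<in>{0..1}. F (x, t) = (toral_map A x, \<phi> x t))
     \<and> (\<forall>x. \<phi> x 0 = 0 \<and> \<phi> x 1 = 1)
     \<and> NS_map (\<phi> p) \<and> SN_map (\<phi> q)
     \<and> (\<forall>x. \<forall>t\<in>{0..1}. contraction_rate A < fibre_deriv (\<phi> x) t
                       \<and> fibre_deriv (\<phi> x) t < inverse (contraction_rate A))"

definition topologically_transitive_on ::
  "'a::topological_space set \<Rightarrow> ('a \<Rightarrow> 'a) \<Rightarrow> bool" where
  "topologically_transitive_on M F \<longleftrightarrow> continuous_on M F \<and> F ` M \<subseteq> M \<and>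
     (\<forall>U V. openin (top_of_set M) U \<and> openin (top_of_set M) V \<and> U \<noteq> {} \<and> V \<noteq> {} \<longrightarrow>
        (\<exists>m>0. (F ^^ m) ` U \<inter> V \<noteq> {}))"

end

theory Submission
  imports Defs "HOL-Computational_Algebra.Polynomial"
begin

text \<open>The base is linear, so an orbit can be prescribed explicitly: starting near a given point of
  \<open>W\<^sup>s(p)\<close>, spending time \<open>n\<close> near \<open>p\<close>, crossing along a point of \<open>W\<^sup>u(p) \<inter> W\<^sup>s(q)\<close>, spending time \<open>m\<close>
  near \<open>q\<close> and ending near a given point of \<open>W\<^sup>u(q)\<close>; both manifolds are dense.  Near \<open>p\<close> the fibre
  coordinate \<open>t\<close> tends to \<open>0\<close>, and since \<open>\<phi>\<^sub>x(t) = t * exp (\<gamma> x t)\<close> with \<open>\<gamma>\<close> Lipschitz, the errors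
  \<open>\<gamma> x t - \<gamma> p 0\<close> are summable along the passage, so that \<open>ln t = n * ln (\<phi>\<^sub>p'(0)) + S\<^sub>1 + o(1)\<close> after it.
  Running the fibre maps backwards from a target height, \<open>m\<close> steps near \<open>q\<close> require
  \<open>ln t = S\<^sub>2 - m * ln (\<phi>\<^sub>q'(0)) + o(1)\<close> at the crossing.  As the quotient of the two logarithms is
  irrational, the two values can be matched with arbitrary precision for large \<open>n\<close> and \<open>m\<close>, and
  the passage near \<open>q\<close> distorts logarithmic distances by a bounded factor only.\<close>

section \<open>Passages near a fixed fibre\<close>

text \<open>The pair (n, m) is chosen only after \<open>S\<^sub>1\<close> and
  \<open>S\<^sub>2\<close> are known, so these constants must not depend on how the two waiting
  times grow. They are therefore limits along the product of two filters at infinity, and n and m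
  enter the base orbits only through exponents of eigenvalues. The crossing happens at a height
  tending to 0, and the second passage expands heights near 0 by a factor that grows exponentially
  in m. Being close to the required height in the ordinary distance is thus worthless; relative
  closeness, that is a small difference of logarithms, survives. The summability of the errors needs
  heights that decay geometrically. The logarithm does not show this, since a step near height 1
  changes it by very little; the logit ln (t / (1 - t)) decreases at a uniform rate over the whole
  fibre. The estimates are made with vectors of the plane, where distances and eigendirections are
  at hand. Splitting the difference of lifts of p and q along the eigendirections yields the
  heteroclinic point.\<close>

lemma sum_two_ended:
  fixes h :: "nat \<Rightarrow> 'a::comm_monoid_add"
  shows "(\<Sum>k<N. h k) = (\<Sum>k<N div 2. h k) + (\<Sum>k<N - N div 2. h (N - Suc k))"
proof -
  have "{..<N} = {..<N div 2} \<union> {N div 2..<N}" by auto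
  then have "(\<Sum>k<N. h k) = (\<Sum>k<N div 2. h k) + (\<Sum>k\<in>{N div 2..<N}. h k)"
    by (simp add: sum.union_disjoint ivl_disj_int)
  also have "(\<Sum>k\<in>{N div 2..<N}. h k) = (\<Sum>k<N - N div 2. h (N - Suc k))"
    by (rule sum.reindex_bij_witness[where i="\<lambda>k. N - Suc k" and j="\<lambda>k. N - Suc k"]) auto
  finally show ?thesis .
qed

text \<open>Dominated convergence for sums with a growing number of terms: replacing the terms from
  index \<open>N w\<close> on by 0 turns them into full series, to which Tannery's theorem
  applies.\<close>

lemma tannery_sum:
  fixes h :: "nat \<Rightarrow> 'w \<Rightarrow> real"
  assumes F: "F \<noteq> bot" and M: "summable M"
    and bound: "\<And>k w. k < N w \<Longrightarrow> \<bar>h k w\<bar> \<le> M k"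
    and N: "filterlim N at_top F"
    and lim: "\<And>k. ((\<lambda>w. h k w) \<longlongrightarrow> b k) F"
  shows "((\<lambda>w. \<Sum>k<N w. h k w) \<longlongrightarrow> suminf b) F"
proof -
  define a where "a = (\<lambda>k w. if k < N w then h k w else 0)"
  \<comment> \<open>Every \<open>k\<close> is below some \<open>N w\<close>, where
    \<open>M k\<close> dominates an absolute value.\<close>
  have M0: "0 \<le> M k" for k
  proof -
    have "eventually (\<lambda>w. k < N w) F"
      by (rule eventually_compose_filterlim[OF eventually_gt_at_top N])
    then obtain w where "k < N w"
      using F eventually_happens' by blast
    then show ?thesis using bound[of k w] by linarith
  qed
  have "((\<lambda>w. \<Sum>k. a k w) \<longlongrightarrow> suminf b) F"
  proof (rule tannerys_theorem[THEN conjunct2, THEN conjunct2])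
    show "((\<lambda>w. a k w) \<longlongrightarrow> b k) F" for k
    proof (rule Lim_transform_eventually[OF lim[of k]])
      have "eventually (\<lambda>w. k < N w) F"
        by (rule eventually_compose_filterlim[OF eventually_gt_at_top N])
      then show "eventually (\<lambda>w. h k w = a k w) F"
        by eventually_elim (simp add: a_def)
    qed
    show "eventually (\<lambda>(k, w). norm (a k w) \<le> M k) (at_top \<times>\<^sub>F F)"
      by (rule always_eventually) (auto simp: a_def bound M0)
  qed (use M F in auto)
  moreover have "(\<Sum>k. a k w) = (\<Sum>k<N w. h k w)" for w
  proof -
    have "(\<lambda>k. if k \<in> {..<N w} then h k w else 0) sums (\<Sum>k<N w. h k w)"
      by (rule sums_If_finite_set) simp
    then show ?thesis by (simp add: a_def sums_iff)
  qed
  ultimately show ?thesis by simp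
qed

text \<open>Limits are known only at a fixed distance from one of the two ends, so the sum is cut in
  the middle and each half is indexed from its own end. There the far power of \<rho> is at most the
  near one, and \<open>2 * C * \<rho> ^ k\<close> dominates both halves.\<close>

lemma tannery_two_ended:
  fixes h :: "'w \<Rightarrow> nat \<Rightarrow> real"
  assumes F: "F \<noteq> bot" and \<rho>: "0 \<le> \<rho>" "\<rho> < 1" and C: "0 \<le> C"
    and bound: "\<And>w k. k < N w \<Longrightarrow> \<bar>h w k\<bar> \<le> C * (\<rho> ^ k + \<rho> ^ (N w - Suc k))"
    and N: "filterlim N at_top F"
    and a: "\<And>k. ((\<lambda>w. h w k) \<longlongrightarrow> a k) F"
    and b: "\<And>k. ((\<lambda>w. h w (N w - Suc k)) \<longlongrightarrow> b k) F"
  shows "((\<lambda>w. \<Sum>k<N w. h w k) \<longlongrightarrow> suminf a + suminf b) F"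
proof -
  have sm: "summable (\<lambda>k. 2 * C * \<rho> ^ k)"
    using \<rho> by (intro summable_mult summable_geometric) auto
  have N2: "filterlim (\<lambda>w. N w div 2) at_top F"
    unfolding filterlim_at_top
  proof
    fix Z
    have "eventually (\<lambda>w. 2 * Z \<le> N w) F"
      using N by (simp add: filterlim_at_top)
    then show "eventually (\<lambda>w. Z \<le> N w div 2) F"
      by eventually_elim linarith
  qed
  have N3: "filterlim (\<lambda>w. N w - N w div 2) at_top F"
    by (rule filterlim_at_top_mono[OF N2]) (auto intro!: always_eventually)
  have pw: "\<rho> ^ i \<le> \<rho> ^ j" if "j \<le> i" for i j
    using \<rho> that by (intro power_decreasing) auto
  have le: "\<bar>x\<bar> \<le> 2 * C * \<rho> ^ j" if "\<bar>x\<bar> \<le> C * (\<rho> ^ k + \<rho> ^ l)" "j \<le> k" "j \<le> l" for x j k l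
  proof -
    have "C * (\<rho> ^ k + \<rho> ^ l) \<le> C * (\<rho> ^ j + \<rho> ^ j)"
      using that C by (intro mult_left_mono add_mono pw) auto
    then show ?thesis using that by simp
  qed
  have 1: "((\<lambda>w. \<Sum>k<N w div 2. h w k) \<longlongrightarrow> suminf a) F"
  proof (rule tannery_sum[OF F sm _ N2 a])
    fix k w assume "k < N w div 2"
    then show "\<bar>h w k\<bar> \<le> 2 * C * \<rho> ^ k"
      by (intro le[OF bound]) auto
  qed
  have 2: "((\<lambda>w. \<Sum>k<N w - N w div 2. h w (N w - Suc k)) \<longlongrightarrow> suminf b) F"
  proof (rule tannery_sum[OF F sm _ N3 b])
    fix k w assume "k < N w - N w div 2"
    then show "\<bar>h w (N w - Suc k)\<bar> \<le> 2 * C * \<rho> ^ k"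
      by (intro le[OF bound]) auto
  qed
  have eq: "(\<lambda>w. \<Sum>k<N w. h w k) =
      (\<lambda>w. (\<Sum>k<N w div 2. h w k) + (\<Sum>k<N w - N w div 2. h w (N w - Suc k)))"
    by (rule ext) (rule sum_two_ended)
  show ?thesis
    unfolding eq by (rule tendsto_add[OF 1 2])
qed

lemma sum_two_ended_geometric_le:
  fixes \<rho> :: real
  assumes "0 \<le> \<rho>" "\<rho> < 1" "k \<le> N"
  shows "(\<Sum>i<k. \<rho> ^ i + \<rho> ^ (N - Suc i)) \<le> 2 / (1 - \<rho>)"
proof -
  have geo: "(\<Sum>i<N. \<rho> ^ i) \<le> 1 / (1 - \<rho>)"
  proof -
    have "(\<Sum>i<N. \<rho> ^ i) \<le> (\<Sum>i. \<rho> ^ i)"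
      using assms by (intro sum_le_suminf summable_geometric) auto
    then show ?thesis using assms by (simp add: suminf_geometric)
  qed
  have "(\<Sum>i<k. \<rho> ^ i + \<rho> ^ (N - Suc i)) \<le> (\<Sum>i<N. \<rho> ^ i + \<rho> ^ (N - Suc i))"
    using assms by (intro sum_mono2) auto
  also have "\<dots> = (\<Sum>i<N. \<rho> ^ i) + (\<Sum>i<N. \<rho> ^ i)"
    by (simp add: sum.distrib sum.nat_diff_reindex)
  finally show ?thesis using geo by simp
qed

text \<open>Asymptotics of a fibre coordinate along base orbits that come from one end point and leave
  to another while spending the time \<open>N w\<close> near the fixed point \<open>p\<close>: the logarithm is a Birkhoff sum
  whose terms differ from \<open>\<gamma> p 0\<close> by something geometrically small away from both ends.\<close>

lemma fibre_passage:
  fixes t :: "'w \<Rightarrow> nat \<Rightarrow> real" and z :: "'w \<Rightarrow> nat \<Rightarrow> 'v::metric_space"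
    and \<gamma> :: "'v \<Rightarrow> real \<Rightarrow> real"
  assumes F: "F \<noteq> bot" and N: "filterlim N at_top F"
    and \<rho>: "0 < \<rho>" "\<rho> < 1" and C: "0 \<le> C" and L: "0 \<le> L" and c: "0 < c"
    and lip: "\<And>v v' s s'. \<lbrakk>v \<in> K; v' \<in> K; s \<in> {0..1}; s' \<in> {0..1}\<rbrakk> \<Longrightarrow>
        \<bar>\<gamma> v s - \<gamma> v' s'\<bar> \<le> L * (dist v v' + \<bar>s - s'\<bar>)"
    and zK: "\<And>w k. k < N w \<Longrightarrow> z w k \<in> K" and pK: "p \<in> K"
    and zp: "\<And>w k. k < N w \<Longrightarrow> dist (z w k) p \<le> C * (\<rho> ^ k + \<rho> ^ (N w - Suc k))"
    and za: "\<And>k. ((\<lambda>w. z w k) \<longlongrightarrow> a k) F" and aK: "\<And>k. a k \<in> K"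
    and zb: "\<And>k. ((\<lambda>w. z w (N w - Suc k)) \<longlongrightarrow> b k) F" and bK: "\<And>k. b k \<in> K"
    and t0: "\<And>w. t w 0 = t0"
    and t01: "\<And>w k. k \<le> N w \<Longrightarrow> t w k \<in> {0<..<1}"
    and tS: "\<And>w k. k < N w \<Longrightarrow> t w (Suc k) = t w k * exp (\<gamma> (z w k) (t w k))"
    and logit: "\<And>w k. k < N w \<Longrightarrow>
        ln (t w (Suc k) / (1 - t w (Suc k))) \<le> ln (t w k / (1 - t w k)) - c + L * dist (z w k) p"
  obtains B S where "\<And>w k. k \<le> N w \<Longrightarrow> t w k \<le> B * exp (- c) ^ k"
    and "((\<lambda>w. ln (t w (N w)) - N w * \<gamma> p 0) \<longlongrightarrow> S) F"
proof -
  define lg where "lg = (\<lambda>s::real. ln (s / (1 - s)))"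
  \<comment> \<open>\<open>Q\<close> bounds the logit apart from its drift \<open>- c * k\<close>:
    the base errors sum to at most two geometric series, uniformly in \<open>N w\<close>.\<close>
  define Q where "Q = lg t0 + L * C * (2 / (1 - \<rho>))"
  define B where "B = exp Q"
  have lgb: "lg (t w k) \<le> lg t0 + L * C * (\<Sum>i<k. \<rho> ^ i + \<rho> ^ (N w - Suc i)) - c * k"
    if "k \<le> N w" for w k
    using that
  proof (induction k)
    case (Suc k)
    then have k: "k < N w" by simp
    have "lg (t w (Suc k)) \<le> lg (t w k) - c + L * dist (z w k) p"
      using logit[OF k] by (simp add: lg_def)
    also have "\<dots> \<le> lg (t w k) - c + L * (C * (\<rho> ^ k + \<rho> ^ (N w - Suc k)))"
      using zp[OF k] L by (intro add_mono mult_left_mono) auto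
    finally show ?case using Suc.IH k by (simp add: algebra_simps)
  qed (simp add: t0)
  have tB: "t w k \<le> B * exp (- c) ^ k" if k: "k \<le> N w" for w k
  proof -
    have t: "0 < t w k" "t w k < 1" using t01[OF k] by auto
    have "L * C * (\<Sum>i<k. \<rho> ^ i + \<rho> ^ (N w - Suc i)) \<le> L * C * (2 / (1 - \<rho>))"
      using \<rho> k L C by (intro mult_left_mono sum_two_ended_geometric_le) auto
    then have "lg (t w k) \<le> Q - c * k"
      using lgb[OF k] by (simp add: Q_def)
    then have "exp (lg (t w k)) \<le> exp (Q + k * (-c))"
      by (simp add: algebra_simps)
    also have "\<dots> = B * exp (- c) ^ k"
      by (simp only: exp_add exp_of_nat_mult B_def)
    finally have "exp (lg (t w k)) \<le> B * exp (- c) ^ k" .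
    moreover have "t w k \<le> exp (lg (t w k))"
    proof -
      have "t w k \<le> t w k / (1 - t w k)"
        using t by (simp add: field_simps)
      then show ?thesis using t by (simp add: lg_def)
    qed
    ultimately show ?thesis by linarith
  qed
  have ev: "eventually (\<lambda>w. k < N w) F" for k
    by (rule eventually_compose_filterlim[OF eventually_gt_at_top N])
  have lipT: "((\<lambda>w. \<gamma> (x w) (s w)) \<longlongrightarrow> \<gamma> x0 s0) F"
    if x: "(x \<longlongrightarrow> x0) F" and s: "(s \<longlongrightarrow> s0) F" and x0: "x0 \<in> K" and s0: "s0 \<in> {0..1}"
      and e: "eventually (\<lambda>w. x w \<in> K \<and> s w \<in> {0..1}) F" for x x0 s s0
  proof (rule Lim_null[THEN iffD2], rule Lim_null_comparison)
    show "eventually (\<lambda>w. norm (\<gamma> (x w) (s w) - \<gamma> x0 s0) \<le> L * (dist (x w) x0 + \<bar>s w - s0\<bar>)) F"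
      using e by eventually_elim (use lip x0 s0 in auto)
    have "((\<lambda>w. L * (dist (x w) x0 + \<bar>s w - s0\<bar>)) \<longlongrightarrow> L * (dist x0 x0 + \<bar>s0 - s0\<bar>)) F"
      by (intro tendsto_intros x s)
    then show "((\<lambda>w. L * (dist (x w) x0 + \<bar>s w - s0\<bar>)) \<longlongrightarrow> 0) F" by simp
  qed
  \<comment> \<open>At a fixed time only finitely many steps have been made, each continuous in base
    point and height.\<close>
  have "\<exists>s\<in>{0..1}. ((\<lambda>w. t w k) \<longlongrightarrow> s) F" for k
  proof (induction k)
    case 0
    obtain w where "0 < N w" using ev[of 0] F eventually_happens' by blast
    then have "t0 \<in> {0..1}" using t01[of 0 w] t0[of w] by auto
    then show ?case by (auto simp: t0 intro!: bexI[of _ t0])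
  next
    case (Suc k)
    then obtain s where s: "s \<in> {0..1}" "((\<lambda>w. t w k) \<longlongrightarrow> s) F" by auto
    have "((\<lambda>w. \<gamma> (z w k) (t w k)) \<longlongrightarrow> \<gamma> (a k) s) F"
    proof (rule lipT[OF za s(2) aK s(1)])
      show "\<forall>\<^sub>F w in F. z w k \<in> K \<and> t w k \<in> {0..1}"
        using ev[of k]
      proof eventually_elim
        case (elim w)
        then show ?case using zK[of k w] t01[of k w] by auto
      qed
    qed
    then have "((\<lambda>w. t w k * exp (\<gamma> (z w k) (t w k))) \<longlongrightarrow> s * exp (\<gamma> (a k) s)) F"
      by (intro tendsto_intros s)
    then have lim: "((\<lambda>w. t w (Suc k)) \<longlongrightarrow> s * exp (\<gamma> (a k) s)) F"
    proof (rule Lim_transform_eventually)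
      show "\<forall>\<^sub>F w in F. t w k * exp (\<gamma> (z w k) (t w k)) = t w (Suc k)"
        using ev[of k] by eventually_elim (simp add: tS)
    qed
    moreover have "s * exp (\<gamma> (a k) s) \<in> {0..1}"
    proof -
      have "\<forall>\<^sub>F w in F. t w (Suc k) \<in> {0..1}"
        using ev[of k]
      proof eventually_elim
        case (elim w)
        then show ?case using t01[of "Suc k" w] by auto
      qed
      then show ?thesis
        using Lim_in_closed_set[OF closed_atLeastAtMost _ F lim] by blast
    qed
    ultimately show ?case by blast
  qed
  then obtain s where s: "\<And>k. s k \<in> {0..1}" "\<And>k. ((\<lambda>w. t w k) \<longlongrightarrow> s k) F"
    by metis
  \<comment> \<open>A common rate for the base distances and for the decay of the heights.\<close>
  define \<kappa> where "\<kappa> = max \<rho> (exp (- c))"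
  have \<kappa>: "0 \<le> \<kappa>" "\<kappa> < 1" "\<rho> \<le> \<kappa>" "exp (- c) \<le> \<kappa>"
    using \<rho> c by (auto simp: \<kappa>_def)
  have B0: "0 < B" by (simp add: B_def)
  define h where "h = (\<lambda>w k. \<gamma> (z w k) (t w k) - \<gamma> p 0)"
  have hb: "\<bar>h w k\<bar> \<le> (L * (C + B)) * (\<kappa> ^ k + \<kappa> ^ (N w - Suc k))" if k: "k < N w" for w k
  proof -
    have t: "0 < t w k" "t w k < 1" using t01[of k w] k by auto
    have "\<bar>h w k\<bar> \<le> L * (dist (z w k) p + \<bar>t w k - 0\<bar>)"
      unfolding h_def using zK[OF k] pK t by (intro lip) auto
    also have "\<dots> \<le> L * (C * (\<rho> ^ k + \<rho> ^ (N w - Suc k)) + B * exp (- c) ^ k)"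
      using zp[OF k] tB[of k w] k L t by (intro mult_left_mono add_mono) auto
    also have "\<dots> \<le> L * (C * (\<kappa> ^ k + \<kappa> ^ (N w - Suc k)) + B * (\<kappa> ^ k + \<kappa> ^ (N w - Suc k)))"
    proof -
      have 1: "\<rho> ^ i \<le> \<kappa> ^ i" for i using \<rho> \<kappa> by (intro power_mono) auto
      have "exp (- c) ^ k \<le> \<kappa> ^ k" using \<kappa> by (intro power_mono) auto
      then have "exp (- c) ^ k \<le> \<kappa> ^ k + \<kappa> ^ (N w - Suc k)" using \<kappa> by (simp add: add_increasing2)
      then show ?thesis
        using L C B0 by (intro mult_left_mono add_mono 1) auto
    qed
    finally show ?thesis by (simp add: algebra_simps)
  qed
  have ha: "((\<lambda>w. h w k) \<longlongrightarrow> \<gamma> (a k) (s k) - \<gamma> p 0) F" for k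
    unfolding h_def
  proof (intro tendsto_diff tendsto_const lipT za aK s)
    show "\<forall>\<^sub>F w in F. z w k \<in> K \<and> t w k \<in> {0..1}"
      using ev[of k]
    proof eventually_elim
      case (elim w)
      then show ?case using zK[of k w] t01[of k w] by auto
    qed
  qed
  \<comment> \<open>Counted from the end, the elapsed time tends to infinity and the height has died
    out; the limit terms at this end are therefore taken at height 0.\<close>
  have tail: "((\<lambda>w. t w (N w - Suc k)) \<longlongrightarrow> 0) F" for k
  proof (rule tendsto_sandwich)
    show "\<forall>\<^sub>F w in F. 0 \<le> t w (N w - Suc k)"
    proof (intro always_eventually allI)
      fix w show "0 \<le> t w (N w - Suc k)" using t01[of "N w - Suc k" w] by auto
    qed
    show "\<forall>\<^sub>F w in F. t w (N w - Suc k) \<le> B * exp (- c) ^ (N w - Suc k)"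
      by (intro always_eventually allI tB) auto
    have "filterlim (\<lambda>w. N w - Suc k) at_top F"
      using filterlim_compose[OF filterlim_minus_const_nat_at_top N] .
    moreover have "(\<lambda>n. exp (- c) ^ n) \<longlonglongrightarrow> 0"
      using c by (intro LIMSEQ_realpow_zero) auto
    ultimately have "((\<lambda>w. exp (- c) ^ (N w - Suc k)) \<longlongrightarrow> 0) F"
      by (rule filterlim_compose[rotated])
    then show "((\<lambda>w. B * exp (- c) ^ (N w - Suc k)) \<longlongrightarrow> 0) F"
      by (rule tendsto_mult_right_zero)
  qed simp
  have hb': "((\<lambda>w. h w (N w - Suc k)) \<longlongrightarrow> \<gamma> (b k) 0 - \<gamma> p 0) F" for k
    unfolding h_def
  proof (intro tendsto_diff tendsto_const lipT zb bK tail)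
    show "\<forall>\<^sub>F w in F. z w (N w - Suc k) \<in> K \<and> t w (N w - Suc k) \<in> {0..1}"
      using ev[of k]
    proof eventually_elim
      case (elim w)
      then show ?case using zK[of "N w - Suc k" w] t01[of "N w - Suc k" w] by auto
    qed
  qed simp
  have "0 \<le> L * (C + B)" using L C B0 by simp
  from tannery_two_ended[OF F \<kappa>(1,2) this hb N ha hb']
  obtain S where S: "((\<lambda>w. \<Sum>k<N w. h w k) \<longlongrightarrow> S) F" by blast
  have lnt: "ln (t w k) = ln t0 + (\<Sum>i<k. \<gamma> (z w i) (t w i))" if "k \<le> N w" for w k
    using that
  proof (induction k)
    case (Suc k)
    then have k: "k < N w" by simp
    have "0 < t w k" using t01[of k w] k by auto
    then show ?case using Suc.IH k by (simp add: tS ln_mult)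
  qed (simp add: t0)
  have "((\<lambda>w. ln t0 + (\<Sum>k<N w. h w k)) \<longlongrightarrow> ln t0 + S) F"
    by (intro tendsto_intros S)
  moreover have "ln t0 + (\<Sum>k<N w. h w k) = ln (t w (N w)) - N w * \<gamma> p 0" for w
    by (simp add: lnt h_def sum_subtractf)
  ultimately have "((\<lambda>w. ln (t w (N w)) - N w * \<gamma> p 0) \<longlongrightarrow> ln t0 + S) F"
    by simp
  then show ?thesis using that tB by blast
qed

text \<open>The index runs against the dynamics: \<open>m\<close> is the crossing and 0 the target.
  From \<open>Suc j\<close> to \<open>j\<close> the logarithmic distance grows at most by the factor
  \<open>1 + 2 * L * B * \<rho> ^ Suc j\<close>, and the product of these factors is at most
  \<open>E\<close>. Only the reference orbit \<open>v\<close> is known to be small; \<open>s\<close>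
  inherits this as long as the logarithmic distance stays below 1, which the bound
  \<open>1 / E\<close> at the crossing ensures.\<close>

lemma log_distance_gronwall:
  fixes s v :: "nat \<Rightarrow> real" and \<gamma> :: "nat \<Rightarrow> real \<Rightarrow> real"
  assumes pos: "\<And>j. j \<le> m \<Longrightarrow> 0 < s j \<and> s j \<le> 1" "\<And>j. j \<le> m \<Longrightarrow> 0 < v j \<and> v j \<le> 1"
    and s: "\<And>j. j < m \<Longrightarrow> s j = s (Suc j) * exp (\<gamma> j (s (Suc j)))"
    and v: "\<And>j. j < m \<Longrightarrow> v j = v (Suc j) * exp (\<gamma> j (v (Suc j)))"
    and lip: "\<And>j x y. \<lbrakk>j < m; x \<in> {0..1}; y \<in> {0..1}\<rbrakk> \<Longrightarrow> \<bar>\<gamma> j x - \<gamma> j y\<bar> \<le> L * \<bar>x - y\<bar>"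
    and L: "0 \<le> L" and B: "0 \<le> B" and \<rho>: "0 \<le> \<rho>" "\<rho> < 1" and vB: "\<And>j. j \<le> m \<Longrightarrow> v j \<le> B * \<rho> ^ j"
    and E: "E = exp (2 * L * B / (1 - \<rho>))" and small: "\<bar>ln (s m) - ln (v m)\<bar> \<le> 1 / E"
  shows "\<bar>ln (s 0) - ln (v 0)\<bar> \<le> E * \<bar>ln (s m) - ln (v m)\<bar>"
proof -
  define e where "e = (\<lambda>j. \<bar>ln (s j) - ln (v j)\<bar>)"
  \<comment> \<open>\<open>G j\<close> bounds the product of the distortion factors between the
    crossing and index \<open>j\<close>.\<close>
  define G where "G = (\<lambda>j. exp (2 * L * B * (\<Sum>i\<in>{j<..m}. \<rho> ^ i)))"
  have geo: "(\<Sum>i\<in>{j<..m}. \<rho> ^ i) \<le> 1 / (1 - \<rho>)" for j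
  proof -
    have "(\<Sum>i\<in>{j<..m}. \<rho> ^ i) \<le> (\<Sum>i. \<rho> ^ i)"
      using \<rho> by (intro sum_le_suminf summable_geometric) auto
    then show ?thesis using \<rho> by (simp add: suminf_geometric)
  qed
  have GE: "G j \<le> E" for j
  proof -
    have "2 * L * B * (\<Sum>i\<in>{j<..m}. \<rho> ^ i) \<le> 2 * L * B * (1 / (1 - \<rho>))"
      using L B by (intro mult_left_mono geo) auto
    then show ?thesis by (simp add: G_def E)
  qed
  have E0: "E > 0" by (simp add: E)
  have em: "0 \<le> e m" "e m \<le> 1 / E" using small by (auto simp: e_def)
  have "e (m - i) \<le> G (m - i) * e m" if "i \<le> m" for i
    using that
  proof (induction i)
    case 0
    then show ?case by (simp add: G_def)
  next
    case (Suc i)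
    define j where "j = m - Suc i"
    have j: "j < m" "m - i = Suc j" using Suc.prems by (auto simp: j_def)
    have IH: "e (Suc j) \<le> G (Suc j) * e m" using Suc.IH Suc.prems j by simp
    have p: "0 < s (Suc j)" "s (Suc j) \<le> 1" "0 < v (Suc j)" "v (Suc j) \<le> 1"
      using pos[of "Suc j"] j by auto
    \<comment> \<open>This bound allows \<open>exp d - 1\<close> to be compared with
      \<open>2 * d\<close> below.\<close>
    have e1: "e (Suc j) \<le> 1"
    proof -
      have "G (Suc j) * e m \<le> E * (1 / E)"
        using GE em E0 by (intro mult_mono) (auto simp: G_def)
      then show ?thesis using IH E0 by simp
    qed
    have "e j \<le> e (Suc j) + \<bar>\<gamma> j (s (Suc j)) - \<gamma> j (v (Suc j))\<bar>"
      using p s[OF j(1)] v[OF j(1)] by (simp add: e_def ln_mult)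
    also have "\<dots> \<le> e (Suc j) + L * \<bar>s (Suc j) - v (Suc j)\<bar>"
      using p j by (intro add_mono lip) auto
    also have "\<dots> \<le> e (Suc j) + L * (B * \<rho> ^ Suc j * (2 * e (Suc j)))"
    proof -
      define d where "d = ln (s (Suc j)) - ln (v (Suc j))"
      have "exp d = s (Suc j) / v (Suc j)"
        using p by (simp add: d_def exp_diff)
      then have "s (Suc j) - v (Suc j) = v (Suc j) * (exp d - 1)"
        using p by (simp add: field_simps)
      then have "\<bar>s (Suc j) - v (Suc j)\<bar> = v (Suc j) * \<bar>exp d - 1\<bar>"
        using p by (simp add: abs_mult)
      also have "\<dots> \<le> (B * \<rho> ^ Suc j) * (2 * \<bar>d\<bar>)"
      proof (intro mult_mono)
        show "v (Suc j) \<le> B * \<rho> ^ Suc j" using vB[of "Suc j"] j by simp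
        have d1: "\<bar>d\<bar> \<le> 1" using e1 by (simp add: e_def d_def)
        show "\<bar>exp d - 1\<bar> \<le> 2 * \<bar>d\<bar>"
        proof (cases "d \<ge> 0")
          case True
          then have "exp d \<le> 1 + d + d\<^sup>2" using d1 by (intro exp_bound) auto
          moreover have "d\<^sup>2 \<le> d" using True d1 by (simp add: power2_eq_square mult_left_le)
          ultimately show ?thesis using True by simp
        next
          case False
          then have "exp d \<le> 1" by simp
          then show ?thesis using False exp_ge_add_one_self[of d] by linarith
        qed
      qed (use B \<rho> in auto)
      finally show ?thesis using L by (simp add: mult_left_mono e_def d_def)
    qed
    also have "\<dots> = e (Suc j) * (1 + 2 * L * B * \<rho> ^ Suc j)"
      by (simp add: algebra_simps)
    also have "\<dots> \<le> e (Suc j) * exp (2 * L * B * \<rho> ^ Suc j)"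
      by (intro mult_left_mono exp_ge_add_one_self) (simp add: e_def)
    also have "\<dots> \<le> G (Suc j) * e m * exp (2 * L * B * \<rho> ^ Suc j)"
      using IH by (intro mult_right_mono) auto
    also have "\<dots> = G j * e m"
    proof -
      have "{j<..m} = insert (Suc j) {Suc j<..m}" using j by auto
      then have "(\<Sum>i\<in>{j<..m}. \<rho> ^ i) = \<rho> ^ Suc j + (\<Sum>i\<in>{Suc j<..m}. \<rho> ^ i)"
        by simp
      then have "G j = G (Suc j) * exp (2 * L * B * \<rho> ^ Suc j)"
        unfolding G_def by (simp only: exp_add[symmetric] distrib_left add.commute)
      then show ?thesis by simp
    qed
    finally show ?case by (simp add: j_def)
  qed
  from this[of m] have "e 0 \<le> G 0 * e m" by simp
  also have "\<dots> \<le> E * e m" using GE em by (intro mult_right_mono) auto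
  finally show ?thesis by (simp add: e_def)
qed

text \<open>Multiples of the irrational number \<open>- (a / b)\<close> are dense modulo 1. To make
  both coefficients large, \<open>M\<close> copies of \<open>a\<close> are set aside: they make
  \<open>n * a\<close> so negative that closeness to \<open>x\<close> forces the coefficient of
  \<open>b\<close> to be at least \<open>N\<close>.\<close>

lemma dense_natural_combinations:
  fixes a b :: real
  assumes irr: "a / b \<notin> \<rat>" and a: "a < 0" and b: "0 < b" and \<epsilon>: "0 < \<epsilon>"
  obtains n m :: nat where "n \<ge> N" "m \<ge> N" "\<bar>n * a + m * b - x\<bar> < \<epsilon>"
proof -
  obtain M :: nat where M: "M \<ge> N" "real M * (- a) \<ge> \<bar>x\<bar> + \<epsilon> + real N * b"
  proof -
    obtain M :: nat where "real M \<ge> (\<bar>x\<bar> + \<epsilon> + real N * b) / (- a) + real N"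
      using real_arch_simple by blast
    moreover have "0 \<le> (\<bar>x\<bar> + \<epsilon> + real N * b) / (- a)"
      using a b \<epsilon> by (intro divide_nonneg_pos add_nonneg_nonneg) auto
    ultimately have "real M \<ge> real N" "real M \<ge> (\<bar>x\<bar> + \<epsilon> + real N * b) / (- a)"
      by auto
    then show ?thesis using a that[of M] by (simp add: pos_divide_le_eq minus_divide_right[symmetric] field_simps)
  qed
  define \<theta> where "\<theta> = - (a / b)"
  have "\<theta> \<notin> \<rat>" using irr by (simp add: \<theta>_def)
  moreover have "\<epsilon> / b > 0" using b \<epsilon> by simp
  \<comment> \<open>The term \<open>real M * \<theta>\<close> in the target compensates for the
    \<open>M\<close> copies of \<open>a\<close> that \<open>n\<close> contains besides
    \<open>k\<close>.\<close>
  ultimately obtain h k where k: "k > 0" and hk: "\<bar>of_int k * \<theta> - of_int h - (- x / b - real M * \<theta>)\<bar> < \<epsilon> / b"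
    using sequence_of_fractional_parts_is_dense by metis
  define n where "n = M + nat k"
  have n: "real n = real M + of_int k" using k by (simp add: n_def)
  have "\<bar>real n * a + of_int h * b - x\<bar> = b * \<bar>of_int k * \<theta> - of_int h - (- x / b - real M * \<theta>)\<bar>"
  proof -
    have "b * (of_int k * \<theta> - of_int h - (- x / b - real M * \<theta>)) = - (real n * a + of_int h * b - x)"
      using b by (simp add: n \<theta>_def field_simps)
    moreover have "b * \<bar>y\<bar> = \<bar>b * y\<bar>" for y using b by (simp add: abs_mult)
    ultimately show ?thesis by (simp only: abs_minus_cancel)
  qed
  also have "\<dots> < \<epsilon>" using hk b by (simp add: field_simps)
  finally have *: "\<bar>real n * a + of_int h * b - x\<bar> < \<epsilon>" .
  have "real n * (- a) \<ge> real M * (- a)" using a by (intro mult_right_mono) (auto simp: n_def)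
  then have "of_int h * b \<ge> real N * b" using * M by linarith
  then have "of_int h \<ge> real N" using b by simp
  then have "h \<ge> int N" by linarith
  moreover have "n \<ge> N" using M by (simp add: n_def)
  ultimately show ?thesis using * by (intro that[of n "nat h"]) (auto simp: nat_le_iff)
qed

section \<open>Regularity of the fibre maps\<close>

lemma C1_on_lipschitz:
  assumes f: "C1_on S f" and C: "compact C" "convex C" "C \<subseteq> S"
  obtains L where "0 \<le> L" "\<And>x y. \<lbrakk>x \<in> C; y \<in> C\<rbrakk> \<Longrightarrow> norm (f x - f y) \<le> L * norm (x - y)"
proof -
  obtain f' where der: "\<And>x. x \<in> S \<Longrightarrow> (f has_derivative blinfun_apply (f' x)) (at x within S)"
    and cont: "continuous_on S f'"
    using f by (auto simp: C1_on_def)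
  have "compact (f' ` C)"
    using C cont by (intro compact_continuous_image) (auto intro: continuous_on_subset)
  then obtain L where L: "\<And>x. x \<in> C \<Longrightarrow> norm (f' x) \<le> L" and "0 < L"
    using compact_imp_bounded[THEN bounded_pos[THEN iffD1]] by (metis image_eqI)
  have "norm (f x - f y) \<le> L * norm (x - y)" if "x \<in> C" "y \<in> C" for x y
  proof (rule differentiable_bound[OF C(2) _ _ that])
    show "(f has_derivative blinfun_apply (f' z)) (at z within C)" if "z \<in> C" for z
      using der[of z] C(3) that by (auto intro: has_derivative_subset)
    show "onorm (blinfun_apply (f' z)) \<le> L" if "z \<in> C" for z
      using L[OF that] by (simp add: norm_blinfun.rep_eq)
  qed
  then show ?thesis using \<open>0 < L\<close> by (intro that[of L]) auto
qed

text \<open>Here the second derivative enters: it makes the fibre derivative Lipschitz jointly in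
  base point and height, which turns geometrically small displacements into summable errors.\<close>

lemma C2_on_partial_derivative:
  fixes G :: "'a::euclidean_space \<times> real \<Rightarrow> 'b::real_normed_vector \<times> real"
  assumes G: "C2_on (UNIV \<times> {0..1}) G"
  obtains D where
    "\<And>v t. t \<in> {0..1} \<Longrightarrow> ((\<lambda>t. snd (G (v, t))) has_real_derivative D v t) (at t within {0..1})"
    and "\<And>K. \<lbrakk>compact K; convex K\<rbrakk> \<Longrightarrow> \<exists>L\<ge>0. \<forall>v\<in>K. \<forall>w\<in>K. \<forall>t\<in>{0..1}. \<forall>s\<in>{0..1}.
        \<bar>D v t - D w s\<bar> \<le> L * (dist v w + \<bar>t - s\<bar>)"
proof -
  let ?S = "UNIV \<times> {0..1} :: ('a \<times> real) set"
  obtain G' where der: "\<And>x. x \<in> ?S \<Longrightarrow> (G has_derivative blinfun_apply (G' x)) (at x within ?S)"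
    and C1: "C1_on ?S G'"
    using G by (auto simp: C2_on_def)
  define D where "D = (\<lambda>v t. snd (blinfun_apply (G' (v, t)) (0, 1)))"
  show ?thesis
  proof (rule that[of D])
    fix v :: 'a and t :: real
    assume t: "t \<in> {0..1}"
    have "((\<lambda>t. G (v, t)) has_derivative (\<lambda>h. blinfun_apply (G' (v, t)) (0, h))) (at t within {0..1})"
    proof (rule has_derivative_in_compose2[where f = "\<lambda>t. (v, t)" and g = G and t = ?S and g' = "\<lambda>x. blinfun_apply (G' x)"])
      show "((\<lambda>t. (v, t)) has_derivative (\<lambda>h. (0, h))) (at t within {0..1})"
        by (intro derivative_eq_intros) auto
    qed (use der t in auto)
    then have "((\<lambda>t. snd (G (v, t))) has_derivative (\<lambda>h. snd (blinfun_apply (G' (v, t)) (0, h)))) (at t within {0..1})"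
      by (rule has_derivative_snd)
    moreover have "snd (blinfun_apply (G' (v, t)) (0, h)) = D v t * h" for h
    proof -
      have "(0 :: 'a, h) = h *\<^sub>R (0, 1)" by simp
      then show ?thesis by (simp only: blinfun.scaleR_right D_def) simp
    qed
    ultimately show "((\<lambda>t. snd (G (v, t))) has_real_derivative D v t) (at t within {0..1})"
      by (simp add: has_field_derivative_def)
  next
    fix K :: "'a set" assume K: "compact K" "convex K"
    obtain L where L: "0 \<le> L" and lip: "\<And>x y. \<lbrakk>x \<in> K \<times> {0..1}; y \<in> K \<times> {0..1}\<rbrakk>
        \<Longrightarrow> norm (G' x - G' y) \<le> L * norm (x - y)"
      using C1_on_lipschitz[OF C1, of "K \<times> {0..1}"] K
      by (metis compact_Icc compact_Times convex_Times convex_real_interval(5) Sigma_mono subset_UNIV order_refl)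
    have "\<bar>D v t - D w s\<bar> \<le> L * (dist v w + \<bar>t - s\<bar>)"
      if "v \<in> K" "w \<in> K" "t \<in> {0..1}" "s \<in> {0..1}" for v w t s
    proof -
      have "\<bar>D v t - D w s\<bar> = norm (snd (blinfun_apply (G' (v, t) - G' (w, s)) (0, 1)))"
        by (simp add: D_def blinfun.diff_left)
      also have "\<dots> \<le> norm (blinfun_apply (G' (v, t) - G' (w, s)) (0, 1))"
        by (metis norm_snd_le prod.collapse)
      also have "\<dots> \<le> norm (G' (v, t) - G' (w, s)) * norm (0 :: 'a, 1 :: real)"
        by (rule norm_blinfun)
      also have "\<dots> = norm (G' (v, t) - G' (w, s))"
        by (simp add: norm_Pair)
      also have "\<dots> \<le> L * norm ((v, t) - (w, s))"
        using that by (intro lip) auto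
      also have "\<dots> \<le> L * (dist v w + \<bar>t - s\<bar>)"
        using L norm_Pair_le[of "v - w" "t - s"] by (intro mult_left_mono) (auto simp: dist_norm)
      finally show ?thesis .
    qed
    then show "\<exists>L\<ge>0. \<forall>v\<in>K. \<forall>w\<in>K. \<forall>t\<in>{0..1}. \<forall>s\<in>{0..1}. \<bar>D v t - D w s\<bar> \<le> L * (dist v w + \<bar>t - s\<bar>)"
      using L by blast
  qed
qed

section \<open>Logarithmic versus ordinary distances\<close>

lemma abs_ln_diff_le:
  fixes x y :: real
  assumes "0 < lam" "lam \<le> x" "lam \<le> y"
  shows "\<bar>ln x - ln y\<bar> \<le> \<bar>x - y\<bar> / lam"
proof -
  have *: "ln x - ln y \<le> \<bar>x - y\<bar> / lam" if "lam \<le> x" "lam \<le> y" for x y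
  proof -
    have "ln x - ln y \<le> (x - y) / y"
      using that assms by (intro ln_diff_le) auto
    also have "\<dots> \<le> \<bar>x - y\<bar> / lam"
      using that assms by (intro frac_le) auto
    finally show ?thesis .
  qed
  show ?thesis using *[of x y] *[of y x] assms by (auto simp: abs_if split: if_splits)
qed

text \<open>The logarithm has slope above 1 on the open unit interval; this converts the final
  logarithmic estimate back into a distance.\<close>

lemma abs_diff_le_abs_ln_diff:
  fixes x y :: real
  assumes "x \<in> {0<..<1}" "y \<in> {0<..<1}"
  shows "\<bar>x - y\<bar> \<le> \<bar>ln x - ln y\<bar>"
proof -
  have *: "y - x \<le> \<bar>ln x - ln y\<bar>" if "x \<in> {0<..<1}" "y \<in> {0<..<1}" for x y :: real
  proof -
    have "ln x - ln y \<le> (x - y) / y" using that by (intro ln_diff_le) auto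
    moreover have "(x - y) / y = - ((y - x) / y)" by (simp add: diff_divide_distrib)
    moreover have "y - x \<le> (y - x) / y" if "x \<le> y"
    proof -
      have "(y - x) * y \<le> (y - x) * 1" using that \<open>y \<in> _\<close> by (intro mult_left_mono) auto
      then show ?thesis using \<open>y \<in> _\<close> by (simp add: pos_le_divide_eq)
    qed
    ultimately show ?thesis by linarith
  qed
  show ?thesis using *[OF assms] *[OF assms(2,1)] by (simp add: abs_le_iff abs_minus_commute)
qed

text \<open>Abstracted from the torus so that the same estimates also serve the maps reflected by t
  -> 1 - t. The bound \<open>lam\<close> keeps slopes away from 0, which makes their logarithms and
  the inverse maps Lipschitz.\<close>

locale fibre_family =
  fixes f D :: "'v::metric_space \<Rightarrow> real \<Rightarrow> real" and K :: "'v set" and L lam :: real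
  assumes der: "\<And>v t. \<lbrakk>v \<in> K; t \<in> {0..1}\<rbrakk> \<Longrightarrow> (f v has_real_derivative D v t) (at t within {0..1})"
    and f0: "\<And>v. v \<in> K \<Longrightarrow> f v 0 = 0" and f1: "\<And>v. v \<in> K \<Longrightarrow> f v 1 = 1"
    and L: "0 \<le> L"
    and lipD: "\<And>v w t s. \<lbrakk>v \<in> K; w \<in> K; t \<in> {0..1}; s \<in> {0..1}\<rbrakk>
        \<Longrightarrow> \<bar>D v t - D w s\<bar> \<le> L * (dist v w + \<bar>t - s\<bar>)"
    and lam: "0 < lam" and D_ge: "\<And>v t. \<lbrakk>v \<in> K; t \<in> {0..1}\<rbrakk> \<Longrightarrow> lam \<le> D v t"
begin

text \<open>The value at 0 is the limit of the quotient, so that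
  \<open>f v t = t * slope v t\<close> has a Lipschitz second factor up to the boundary.\<close>

definition slope :: "'v \<Rightarrow> real \<Rightarrow> real" where
  "slope v t = (if t = 0 then D v 0 else f v t / t)"

lemma mvt:
  assumes "v \<in> K" "0 \<le> a" "a < b" "b \<le> 1"
  obtains x where "a < x" "x < b" "f v b - f v a = D v x * (b - a)"
proof -
  have "(f v has_derivative (*) (D v x)) (at x within {a..b})" if "a \<le> x" "x \<le> b" for x
  proof -
    have "(f v has_derivative (*) (D v x)) (at x within {0..1})"
      using der[of v x] assms that by (simp add: has_field_derivative_def)
    then show ?thesis using assms by (auto intro: has_derivative_subset)
  qed
  from mvt_simple[OF assms(3) this] that show ?thesis by auto
qed

lemma increasing:
  assumes "v \<in> K" "0 \<le> a" "a \<le> b" "b \<le> 1"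
  shows "lam * (b - a) \<le> f v b - f v a"
proof (cases "a = b")
  case False
  then obtain x where x: "a < x" "x < b" "f v b - f v a = D v x * (b - a)"
    using mvt[of v a b] assms by auto
  then show ?thesis using D_ge[of v x] assms by (simp add: mult_right_mono)
qed simp

lemma range:
  assumes "v \<in> K" "t \<in> {0<..<1}"
  shows "f v t \<in> {0<..<1}"
proof -
  have "0 < lam * t" "0 < lam * (1 - t)" using assms lam by auto
  then show ?thesis
    using increasing[of v 0 t] increasing[of v t 1] assms by (auto simp: f0 f1)
qed

lemma slope_eq_D:
  assumes "v \<in> K" "0 \<le> t" "t \<le> 1"
  obtains x where "0 \<le> x" "x \<le> t" "slope v t = D v x"
proof (cases "t = 0")
  case True
  then show ?thesis using that[of 0] by (simp add: slope_def)
next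
  case False
  then obtain x where "0 < x" "x < t" "f v t - f v 0 = D v x * (t - 0)"
    using mvt[of v 0 t] assms by auto
  then show ?thesis using that[of x] False assms by (simp add: slope_def f0)
qed

lemma slope_ge: "\<lbrakk>v \<in> K; 0 \<le> t; t \<le> 1\<rbrakk> \<Longrightarrow> lam \<le> slope v t"
  by (metis D_ge atLeastAtMost_iff order_trans slope_eq_D)

text \<open>Mean value theorem for \<open>f v - f w\<close>, which vanishes at 0. The factor
  \<open>t\<close> cancels the denominator of \<open>slope\<close>, so that the dependence on the
  base point stays uniform down to height 0.\<close>

lemma f_diff_base_le:
  assumes v: "v \<in> K" "w \<in> K" and t: "0 \<le> t" "t \<le> 1"
  shows "\<bar>f v t - f w t\<bar> \<le> L * dist v w * t"
proof (cases "t = 0")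
  case True
  then show ?thesis by (simp add: f0 v)
next
  case False
  have "((\<lambda>s. f v s - f w s) has_derivative (*) (D v x - D w x)) (at x within {0..t})"
    if "0 \<le> x" "x \<le> t" for x
  proof -
    have "((\<lambda>s. f v s - f w s) has_real_derivative D v x - D w x) (at x within {0..1})"
      using that t v by (intro DERIV_diff der) auto
    then have "((\<lambda>s. f v s - f w s) has_derivative (*) (D v x - D w x)) (at x within {0..1})"
      by (simp add: has_field_derivative_def)
    then show ?thesis using t by (auto intro: has_derivative_subset)
  qed
  from mvt_simple[OF _ this] obtain x where
    x: "0 < x" "x < t" "(f v t - f w t) - (f v 0 - f w 0) = (D v x - D w x) * (t - 0)"
    using False t by auto
  then have "\<bar>f v t - f w t\<bar> = \<bar>D v x - D w x\<bar> * t"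
    using t by (simp add: f0 v abs_mult)
  also have "\<dots> \<le> L * (dist v w + \<bar>x - x\<bar>) * t"
    using v t x by (intro mult_right_mono lipD) auto
  finally show ?thesis by simp
qed

lemma slope_diff_base_le:
  assumes "v \<in> K" "w \<in> K" "0 \<le> t" "t \<le> 1"
  shows "\<bar>slope v t - slope w t\<bar> \<le> L * dist v w"
proof (cases "t = 0")
  case True
  then show ?thesis using lipD[of v w 0 0] assms by (simp add: slope_def)
next
  case False
  then have "\<bar>slope v t - slope w t\<bar> = \<bar>f v t - f w t\<bar> / t"
    using assms by (simp add: slope_def abs_divide flip: diff_divide_distrib)
  then show ?thesis using f_diff_base_le[OF assms] False assms by (simp add: pos_divide_le_eq)
qed

text \<open>The quotient \<open>f v x / x\<close> has derivative
  \<open>(D v x - slope v x) / x\<close>. Since \<open>slope v x\<close> is itself a value of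
  \<open>D v\<close> at some point of [0, x], the numerator is at most \<open>L * x\<close>, which
  cancels the singularity at 0.\<close>

lemma slope_diff_fibre_le:
  assumes v: "v \<in> K" and s: "0 \<le> s" "s \<le> t" "t \<le> 1"
  shows "\<bar>slope v t - slope v s\<bar> \<le> L * (t - s)"
proof (cases "s = 0 \<or> s = t")
  case True
  obtain x where x: "0 \<le> x" "x \<le> t" "slope v t = D v x"
    using slope_eq_D[of v t] v s by auto
  have "\<bar>D v x - D v 0\<bar> \<le> L * (dist v v + \<bar>x - 0\<bar>)"
    using v s x by (intro lipD) auto
  also have "\<dots> \<le> L * t" using x L by (intro mult_left_mono) auto
  finally show ?thesis using True x by (auto simp: slope_def)
next
  case False
  then have st: "0 < s" "s < t" using s by auto
  have "((\<lambda>r. f v r / r) has_derivative (*) ((D v x - slope v x) / x)) (at x within {s..t})"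
    if "s \<le> x" "x \<le> t" for x
  proof -
    have "((\<lambda>r. f v r / r) has_real_derivative (D v x * x - f v x * 1) / (x * x)) (at x within {0..1})"
      using that st v s by (intro DERIV_divide der DERIV_ident) auto
    moreover have "(D v x * x - f v x * 1) / (x * x) = (D v x - slope v x) / x"
      using that st by (simp add: slope_def field_simps)
    ultimately have "((\<lambda>r. f v r / r) has_derivative (*) ((D v x - slope v x) / x)) (at x within {0..1})"
      by (simp add: has_field_derivative_def)
    then show ?thesis using s by (auto intro: has_derivative_subset)
  qed
  from mvt_simple[OF st(2) this] obtain x where
    x: "s < x" "x < t" "f v t / t - f v s / s = (D v x - slope v x) / x * (t - s)"
    by auto
  obtain y where y: "0 \<le> y" "y \<le> x" "slope v x = D v y"
    using slope_eq_D[of v x] v s x st by auto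
  have "\<bar>D v x - D v y\<bar> \<le> L * (dist v v + \<bar>x - y\<bar>)"
    using v s x y by (intro lipD) auto
  also have "\<dots> \<le> L * x" using y x st L by (intro mult_left_mono) auto
  finally have "\<bar>D v x - slope v x\<bar> / x \<le> L" using x st y by (simp add: field_simps)
  then have "\<bar>(D v x - slope v x) / x\<bar> * (t - s) \<le> L * (t - s)"
    using x st by (intro mult_right_mono) auto
  then show ?thesis using x st by (simp add: slope_def abs_mult)
qed

text \<open>Plays the role of \<gamma> in \<open>t * exp (\<gamma> x t)\<close>.\<close>

definition log_slope :: "'v \<Rightarrow> real \<Rightarrow> real" where
  "log_slope v t = ln (slope v t)"

lemma f_eq: "\<lbrakk>v \<in> K; 0 \<le> t; t \<le> 1\<rbrakk> \<Longrightarrow> f v t = t * exp (log_slope v t)"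
  using slope_ge[of v t] lam by (cases "t = 0") (auto simp: log_slope_def slope_def f0)

lemma log_slope_lipschitz:
  assumes v: "v \<in> K" "w \<in> K" and t: "t \<in> {0..1}" "s \<in> {0..1}"
  shows "\<bar>log_slope v t - log_slope w s\<bar> \<le> L / lam * (dist v w + \<bar>t - s\<bar>)"
proof -
  have "\<bar>slope w t - slope w s\<bar> \<le> L * \<bar>t - s\<bar>"
    using slope_diff_fibre_le[of w s t] slope_diff_fibre_le[of w t s] v t
    by (cases "s \<le> t") (auto simp: abs_minus_commute)
  then have "\<bar>slope v t - slope w s\<bar> \<le> L * (dist v w + \<bar>t - s\<bar>)"
    using slope_diff_base_le[of v w t] v t by (simp add: algebra_simps)
  moreover have "\<bar>log_slope v t - log_slope w s\<bar> \<le> \<bar>slope v t - slope w s\<bar> / lam"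
    unfolding log_slope_def using v t lam by (intro abs_ln_diff_le slope_ge) auto
  ultimately show ?thesis
    using lam by (smt (verit) divide_right_mono times_divide_eq_left)
qed

text \<open>Exchanges the two ends of the fibre, so that the slope estimates at 0 become available
  at 1.\<close>

lemma reflected: "fibre_family (\<lambda>v t. 1 - f v (1 - t)) (\<lambda>v t. D v (1 - t)) K L lam"
proof
  fix v t assume v: "v \<in> K" and t: "t \<in> {0..1::real}"
  have "((\<lambda>t. f v (1 - t)) has_derivative (\<lambda>h. D v (1 - t) * (- h))) (at t within {0..1})"
  proof (rule has_derivative_in_compose2[where t = "{0..1}" and g' = "\<lambda>x. (*) (D v x)" and g = "f v"])
    show "((-) 1 has_derivative uminus) (at t within {0..1})"
      by (auto intro!: derivative_eq_intros)
    show "\<And>x. x \<in> {0..1} \<Longrightarrow> (f v has_derivative (*) (D v x)) (at x within {0..1})"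
      using der[OF v] by (auto simp: has_field_derivative_def)
  qed (use t in auto)
  then have "((\<lambda>t. 1 - f v (1 - t)) has_derivative (\<lambda>h. 0 - D v (1 - t) * (- h))) (at t within {0..1})"
    by (intro has_derivative_diff has_derivative_const)
  then show "((\<lambda>t. 1 - f v (1 - t)) has_real_derivative D v (1 - t)) (at t within {0..1})"
    by (simp add: has_field_derivative_def)
next
  fix v w t s assume "v \<in> K" "w \<in> K" "t \<in> {0..1::real}" "s \<in> {0..1::real}"
  then show "\<bar>D v (1 - t) - D w (1 - s)\<bar> \<le> L * (dist v w + \<bar>t - s\<bar>)"
    using lipD[of v w "1 - t" "1 - s"] by (auto simp: abs_minus_commute)
qed (use f0 f1 L lam D_ge in auto)

definition logit_gain :: "'v \<Rightarrow> real \<Rightarrow> real" where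
  "logit_gain v t = ln (f v t / (1 - f v t)) - ln (t / (1 - t))"

text \<open>The logit gain extends continuously to the closed fibre, with boundary values given by the
  derivatives at the end points; hence its sign over one fibre gives a uniform bound nearby.\<close>

lemma logit_gain_bound:
  assumes p: "p \<in> K" and sg: "sg = 1 \<or> sg = -1"
    and "sg * ln (D p 0) < 0" and "0 < sg * ln (D p 1)"
    and "\<And>t. t \<in> {0<..<1} \<Longrightarrow> sg * (f p t - t) < 0"
  obtains c where "0 < c"
    "\<And>v t. \<lbrakk>v \<in> K; t \<in> {0<..<1}\<rbrakk> \<Longrightarrow> sg * logit_gain v t \<le> - c + 2 * (L / lam) * dist v p"
proof -
  interpret r: fibre_family "\<lambda>v t. 1 - f v (1 - t)" "\<lambda>v t. D v (1 - t)" K L lam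
    by (rule reflected)
  \<comment> \<open>The quotients \<open>f v t / t\<close> and \<open>(1 - f v t) / (1 - t)\<close>
    are the slopes seen from the two ends; the difference of their logarithms is the logit gain
    inside the fibre and remains Lipschitz up to its ends.\<close>
  define g where "g = (\<lambda>v t. log_slope v t - r.log_slope v (1 - t))"
  have lg: "logit_gain v t = g v t" if "v \<in> K" "t \<in> {0<..<1}" for v t
  proof -
    have "f v t / t > 0" "(1 - f v t) / (1 - t) > 0"
      using range[OF that] that by auto
    then show ?thesis
      using range[OF that] that
      by (simp add: logit_gain_def g_def log_slope_def r.log_slope_def slope_def r.slope_def ln_div)
  qed
  have lip: "\<bar>g v t - g w s\<bar> \<le> 2 * (L / lam) * (dist v w + \<bar>t - s\<bar>)"
    if "v \<in> K" "w \<in> K" "t \<in> {0..1}" "s \<in> {0..1}" for v w t s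
    using log_slope_lipschitz[OF that] r.log_slope_lipschitz[OF that(1,2), of "1 - t" "1 - s"] that
    unfolding g_def by (simp add: abs_minus_commute)
  have neg: "sg * g p t < 0" if t: "t \<in> {0..1}" for t
  proof -
    \<comment> \<open>At either end the slope seen from the opposite end is 1, so \<open>g p\<close>
      equals \<open>ln (D p 0)\<close> at 0 and \<open>- ln (D p 1)\<close> at 1.\<close>
    consider "t = 0" | "t = 1" | "t \<in> {0<..<1}" using t by force
    then show ?thesis
    proof cases
      case 1
      then show ?thesis using assms by (simp add: g_def log_slope_def slope_def r.log_slope_def r.slope_def f0)
    next
      case 2
      then show ?thesis using assms by (simp add: g_def log_slope_def slope_def r.log_slope_def r.slope_def f1)
    next
      case 3
      have fr: "0 < f p t" "f p t < 1" using range[OF p 3] by auto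
      have t': "0 < t" "t < 1" using 3 by auto
      show ?thesis
        using sg
      proof
        assume sg1: "sg = 1"
        then have "f p t < t" using assms(5)[OF 3] by simp
        then have "f p t / (1 - f p t) < t / (1 - t)" using fr t' by (simp add: field_simps)
        then have "ln (f p t / (1 - f p t)) < ln (t / (1 - t))" using fr t' by simp
        then show ?thesis using lg[OF p 3] sg1 by (simp add: logit_gain_def)
      next
        assume sg1: "sg = -1"
        then have "t < f p t" using assms(5)[OF 3] by simp
        then have "t / (1 - t) < f p t / (1 - f p t)" using fr t' by (simp add: field_simps)
        then have "ln (t / (1 - t)) < ln (f p t / (1 - f p t))" using fr t' by simp
        then show ?thesis using lg[OF p 3] sg1 by (simp add: logit_gain_def)
      qed
    qed
  qed
  have "continuous_on {0..1} (\<lambda>t. sg * g p t)"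
  proof -
    have "(2 * (L / lam))-lipschitz_on {0..1} (g p)"
      using lip[OF p p] L lam by (intro lipschitz_onI) (auto simp: dist_real_def)
    then show ?thesis
      by (intro continuous_intros) (rule lipschitz_on_continuous_on)
  qed
  from continuous_attains_sup[OF compact_Icc _ this] obtain x where
    x: "x \<in> {0..1}" "\<And>t. t \<in> {0..1} \<Longrightarrow> sg * g p t \<le> sg * g p x" by force
  show ?thesis
  proof (rule that[of "- (sg * g p x)"])
    show "0 < - (sg * g p x)" using neg[OF x(1)] by simp
    fix v t assume v: "v \<in> K" and t: "t \<in> {0<..<1::real}"
    have "sg * (g v t - g p t) \<le> \<bar>g v t - g p t\<bar>" using sg by auto
    also have "\<dots> \<le> 2 * (L / lam) * dist v p" using lip[of v p t t] v p t by auto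
    finally have "sg * g v t \<le> sg * g p t + 2 * (L / lam) * dist v p"
      by (simp add: algebra_simps)
    then show "sg * logit_gain v t \<le> - (- (sg * g p x)) + 2 * (L / lam) * dist v p"
      using x(2)[of t] t lg[OF v t] by auto
  qed
qed

section \<open>Inverse fibre maps\<close>

definition finv :: "'v \<Rightarrow> real \<Rightarrow> real" where
  "finv v = inv_into {0..1} (f v)"

lemma f_image: "v \<in> K \<Longrightarrow> f v ` {0..1} = {0..1}"
proof (intro equalityI subsetI)
  fix s assume v: "v \<in> K" and s: "s \<in> {0..1::real}"
  have "continuous_on {0..1} (f v)"
    using der[OF v] by (intro DERIV_continuous_on) auto
  then show "s \<in> f v ` {0..1}"
    using IVT'[of "f v" 0 s 1] s f0[OF v] f1[OF v] by auto
next
  fix y assume "v \<in> K" "y \<in> f v ` {0..1}"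
  then obtain t where t: "t \<in> {0..1}" "y = f v t" and v: "v \<in> K" by auto
  have "0 \<le> lam * t" "0 \<le> lam * (1 - t)" using lam t by auto
  then show "y \<in> {0..1}"
    using increasing[of v 0 t] increasing[of v t 1] v t by (auto simp: f0 f1)
qed

lemma finv: 
  assumes "v \<in> K" "s \<in> {0..1}"
  shows "finv v s \<in> {0..1}" "f v (finv v s) = s"
  using inv_into_into[of s "f v" "{0..1}"] f_inv_into_f[of s "f v" "{0..1}"] assms
  by (simp_all add: f_image finv_def)

lemma finv_open:
  assumes "v \<in> K" "s \<in> {0<..<1}"
  shows "finv v s \<in> {0<..<1}"
proof -
  have "finv v s \<in> {0..1}" "f v (finv v s) = s" using finv[of v s] assms by auto
  moreover have "finv v s \<noteq> 0" "finv v s \<noteq> 1"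
    using calculation(2) assms f0[of v] f1[of v] by auto
  ultimately show ?thesis by auto
qed

text \<open>Over a fixed base point \<open>f\<close> separates heights by at least the factor
  \<open>lam\<close>, and exchanging the base point moves its values by at most
  \<open>L * dist v w\<close>.\<close>

lemma finv_lipschitz:
  assumes v: "v \<in> K" "w \<in> K" and s: "s \<in> {0..1}" "r \<in> {0..1}"
  shows "\<bar>finv v s - finv w r\<bar> \<le> (\<bar>s - r\<bar> + L * dist v w) / lam"
proof -
  define t u where "t = finv v s" and "u = finv w r"
  have t: "t \<in> {0..1}" "f v t = s" and u: "u \<in> {0..1}" "f w u = r"
    using finv v s by (auto simp: t_def u_def)
  have "lam * \<bar>t - u\<bar> \<le> \<bar>f v t - f v u\<bar>"
    using increasing[of v t u] increasing[of v u t] v t u lam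
    by (cases "t \<le> u") (auto simp: abs_if)
  also have "\<dots> \<le> \<bar>s - r\<bar> + \<bar>f v u - f w u\<bar>" using t u by linarith
  also have "\<bar>f v u - f w u\<bar> \<le> L * dist v w * u" using f_diff_base_le[of v w u] v u by auto
  also have "L * dist v w * u \<le> L * dist v w" using u L by (intro mult_left_le) auto
  finally show ?thesis using lam by (simp add: t_def u_def field_simps)
qed

text \<open>Gives the inverse maps the same form \<open>s * exp (...)\<close> as the maps
  themselves, so that a passage run backwards also falls under \<open>fibre_passage\<close>.\<close>

definition log_slope_inv :: "'v \<Rightarrow> real \<Rightarrow> real" where
  "log_slope_inv v s = - log_slope v (finv v s)"

lemma finv_eq:
  assumes "v \<in> K" "s \<in> {0..1}"
  shows "finv v s = s * exp (log_slope_inv v s)"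
  using finv[OF assms] f_eq[of v "finv v s"] assms
  by (simp add: log_slope_inv_def exp_minus field_simps)

lemma log_slope_inv_lipschitz:
  assumes v: "v \<in> K" "w \<in> K" and s: "s \<in> {0..1}" "r \<in> {0..1}"
  shows "\<bar>log_slope_inv v s - log_slope_inv w r\<bar>
    \<le> L / lam * (1 + (1 + L) / lam) * (dist v w + \<bar>s - r\<bar>)"
proof -
  have "\<bar>log_slope_inv v s - log_slope_inv w r\<bar> \<le> L / lam * (dist v w + \<bar>finv v s - finv w r\<bar>)"
    using log_slope_lipschitz[of v w "finv v s" "finv w r"] finv v s
    by (simp add: log_slope_inv_def abs_minus_commute)
  also have "\<dots> \<le> L / lam * ((1 + (1 + L) / lam) * (dist v w + \<bar>s - r\<bar>))"
  proof (intro mult_left_mono)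
    have "(\<bar>s - r\<bar> + L * dist v w) / lam \<le> (1 + L) / lam * (dist v w + \<bar>s - r\<bar>)"
      using L lam by (simp add: divide_simps algebra_simps)
    moreover have "dist v w \<le> dist v w + \<bar>s - r\<bar>" by simp
    ultimately show "dist v w + \<bar>finv v s - finv w r\<bar> \<le> (1 + (1 + L) / lam) * (dist v w + \<bar>s - r\<bar>)"
      using finv_lipschitz[OF v s] unfolding distrib_right mult_1 by linarith
  qed (use L lam in auto)
  finally show ?thesis by (simp add: mult.assoc)
qed

end

section \<open>The torus\<close>

text \<open>After an integer shift, a multiple of \<open>e\<close> can match the first coordinate of
  \<open>v\<close> exactly. The remaining error in the second coordinate is governed by the
  multiples of the slope modulo 1, which are dense.\<close>

lemma irrational_line_dense:
  fixes e v :: "real^2"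
  assumes e: "e $ 1 \<noteq> 0" "e $ 2 / e $ 1 \<notin> \<rat>" and \<epsilon>: "0 < \<epsilon>"
  obtains s l where "\<And>i. l $ i \<in> \<int>" "dist (s *\<^sub>R e + l) v < \<epsilon>"
proof -
  define \<theta> where "\<theta> = e $ 2 / e $ 1"
  obtain h k where hk: "\<bar>of_int k * \<theta> - of_int h - (v $ 1 * \<theta> - v $ 2)\<bar> < \<epsilon>"
    using sequence_of_fractional_parts_is_dense[of \<theta> \<epsilon>] e \<epsilon> unfolding \<theta>_def by metis
  define l where "l = (vector [of_int k, of_int h] :: real^2)"
  define s where "s = (v $ 1 - of_int k) / e $ 1"
  define y where "y = s *\<^sub>R e + l - v"
  have "y $ 1 = 0" using e by (simp add: y_def s_def l_def)
  moreover have "y $ 2 = - (of_int k * \<theta> - of_int h - (v $ 1 * \<theta> - v $ 2))"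
    using e by (simp add: y_def s_def l_def \<theta>_def field_simps)
  ultimately have "norm y < \<epsilon>"
    using hk norm_le_l1_cart[of y] by (simp add: UNIV_2)
  moreover have "l $ i \<in> \<int>" for i
    using exhaust_2[of i] by (auto simp: l_def)
  ultimately show ?thesis by (intro that[of l s]) (auto simp: y_def dist_norm)
qed

text \<open>The eigenvalues are real and irrational, since a rational one would be an integer
  dividing the determinant. Hence the eigenlines have irrational slope and are dense modulo integer
  vectors.\<close>

lemma anosov_matrix_eigenbasis:
  assumes A: "anosov_matrix A"
  obtains \<mu> \<nu> :: real and e\<^sub>s e\<^sub>u :: "real^2"
  where "\<bar>\<mu>\<bar> < 1" "\<mu> \<noteq> 0" "\<bar>\<mu> * \<nu>\<bar> = 1"
    and "of_int_matrix A *v e\<^sub>s = \<mu> *\<^sub>R e\<^sub>s" "of_int_matrix A *v e\<^sub>u = \<nu> *\<^sub>R e\<^sub>u"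
    and "\<And>v. \<exists>x y. v = x *\<^sub>R e\<^sub>s + y *\<^sub>R e\<^sub>u"
    and "\<And>v \<epsilon>. 0 < \<epsilon> \<Longrightarrow> \<exists>s l. (\<forall>i. l $ i \<in> \<int>) \<and> dist (s *\<^sub>R e\<^sub>s + l) v < \<epsilon>"
    and "\<And>v \<epsilon>. 0 < \<epsilon> \<Longrightarrow> \<exists>s l. (\<forall>i. l $ i \<in> \<int>) \<and> dist (s *\<^sub>R e\<^sub>u + l) v < \<epsilon>"
proof -
  define a b c d where "a = A $ 1 $ 1" and "b = A $ 1 $ 2" and "c = A $ 2 $ 1" and "d = A $ 2 $ 2"
  define tr dt where "tr = a + d" and "dt = a * d - b * c"
  have ev: "complex_eigenvalue A z \<longleftrightarrow> z\<^sup>2 - of_int tr * z + of_int dt = 0" for z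
    by (simp add: complex_eigenvalue_iff tr_def dt_def det_2 a_def b_def c_def d_def)
  have nz: "cmod z \<noteq> 1" if "z\<^sup>2 - of_int tr * z + of_int dt = 0" for z
    using A that by (auto simp: anosov_matrix_def ev)
  have nzr: "\<bar>x\<bar> \<noteq> 1" if "x\<^sup>2 - of_int tr * x + of_int dt = 0" for x :: real
  proof -
    have "(complex_of_real x)\<^sup>2 - of_int tr * complex_of_real x + of_int dt
        = complex_of_real (x\<^sup>2 - of_int tr * x + of_int dt)" by simp
    then show ?thesis using nz[of "of_real x"] that by simp
  qed
  obtain B where "A ** B = mat 1"
    using A by (auto simp: anosov_matrix_def invertible_def)
  then have "det A * det B = 1" by (metis det_I det_mul)
  then have "\<bar>det A\<bar> = 1" by (metis abs_mult abs_1 abs_zmult_eq_1)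
  then have dt: "\<bar>dt\<bar> = 1" by (simp add: dt_def det_2 a_def b_def c_def d_def)
  \<comment> \<open>Otherwise the matrix is triangular, and its diagonal entry \<open>a\<close> is
    an eigenvalue dividing the determinant.\<close>
  have b0: "b \<noteq> 0"
  proof
    assume "b = 0"
    then have "\<bar>a * d\<bar> = 1" using dt by (simp add: dt_def)
    then have "\<bar>a\<bar> = 1" by (rule abs_zmult_eq_1)
    moreover have "(of_int a :: real)\<^sup>2 - of_int tr * of_int a + of_int dt = 0"
      using \<open>b = 0\<close> by (simp add: tr_def dt_def power2_eq_square algebra_simps)
    ultimately show False using nzr[of "of_int a"] by (metis of_int_1 of_int_abs)
  qed
  define D where "D = (of_int tr)\<^sup>2 - 4 * (of_int dt :: real)"
  \<comment> \<open>Otherwise the two roots are complex conjugates and the square of their common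
    modulus is the determinant.\<close>
  have D: "D > 0"
  proof (rule ccontr)
    assume "\<not> D > 0"
    then have sq: "(sqrt (- D))\<^sup>2 = - D" by simp
    define z where "z = Complex (of_int tr / 2) (sqrt (- D) / 2)"
    have "z\<^sup>2 - of_int tr * z + of_int dt = 0"
      using sq by (simp add: z_def complex_eq_iff power2_eq_square D_def field_simps)
    then have "cmod z \<noteq> 1" by (rule nz)
    moreover have "(cmod z)\<^sup>2 = of_int dt"
      using sq by (simp add: cmod_power2 z_def D_def power_divide diff_divide_distrib)
    ultimately show False using dt
      by (smt (verit) of_int_1 one_power2 power2_eq_iff_nonneg norm_ge_zero of_int_less_0_iff zero_le_power2)
  qed
  have irr: "x \<notin> \<rat>" if x: "x\<^sup>2 - of_int tr * x + of_int dt = 0" for x :: real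
  proof
    assume "x \<in> \<rat>"
    moreover have "algebraic_int x"
    proof (rule algebraic_int.intros)
      show "poly [:of_int dt, - of_int tr, 1:] x = 0"
        using x by (simp add: power2_eq_square algebra_simps)
      show "\<forall>i. coeff [:of_int dt, - of_int tr, 1 :: real:] i \<in> \<int>"
        by (auto simp: coeff_pCons split: nat.splits)
    qed simp
    ultimately obtain i where i: "x = of_int i"
      using rational_algebraic_int_is_int by (auto elim: Ints_cases)
    have "(of_int (i * (tr - i)) :: real) = of_int dt"
      using x by (simp add: i power2_eq_square algebra_simps)
    then have "i * (tr - i) = dt" by (simp only: of_int_eq_iff)
    then have "\<bar>i * (tr - i)\<bar> = 1" using dt by simp
    then have "\<bar>i\<bar> = 1" by (rule abs_zmult_eq_1)
    then show False using nzr[OF x] by (metis i of_int_1 of_int_abs)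
  qed
  define r1 r2 where "r1 = (of_int tr + sqrt D) / 2" and "r2 = (of_int tr - sqrt D) / 2"
  have sD: "(sqrt D)\<^sup>2 = D" using D by simp
  have "r1\<^sup>2 - of_int tr * r1 + of_int dt = 0" "r2\<^sup>2 - of_int tr * r2 + of_int dt = 0"
    and r12: "r1 * r2 = of_int dt" "r1 \<noteq> r2"
    using sD D by (auto simp: r1_def r2_def D_def power2_eq_square field_simps)
  then obtain \<mu> \<nu> :: real where root: "\<mu>\<^sup>2 - of_int tr * \<mu> + of_int dt = 0" "\<nu>\<^sup>2 - of_int tr * \<nu> + of_int dt = 0"
    and prod: "\<mu> * \<nu> = of_int dt" and ne: "\<mu> \<noteq> \<nu>" and less: "\<bar>\<mu>\<bar> < 1"
  proof (cases "\<bar>r1\<bar> < 1")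
    case False
    then have "\<bar>r1\<bar> > 1" using nzr[of r1] \<open>r1\<^sup>2 - of_int tr * r1 + of_int dt = 0\<close> by linarith
    moreover have "\<bar>r1\<bar> * \<bar>r2\<bar> = 1"
      using r12 dt by (metis abs_mult of_int_1 of_int_abs)
    moreover have "\<bar>r1\<bar> * 1 \<le> \<bar>r1\<bar> * \<bar>r2\<bar>" if "1 \<le> \<bar>r2\<bar>"
      using that by (intro mult_left_mono) auto
    ultimately have "\<bar>r2\<bar> < 1" by linarith
    then show ?thesis using that[of r2 r1] r12
      \<open>r1\<^sup>2 - of_int tr * r1 + of_int dt = 0\<close> \<open>r2\<^sup>2 - of_int tr * r2 + of_int dt = 0\<close>
      by (simp add: mult.commute)
  qed blast
  \<comment> \<open>Solves the first row of the eigenvector equation for \<open>x\<close>; the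
    second row then amounts to the characteristic equation.\<close>
  define e where "e = (\<lambda>x. vector [of_int b, x - of_int a] :: real^2)"
  have Ae: "of_int_matrix A *v e x = x *\<^sub>R e x" if "x\<^sup>2 - of_int tr * x + of_int dt = 0" for x
    using that
    by (simp add: vec_eq_iff forall_2 matrix_vector_mult_def UNIV_2 e_def tr_def dt_def
        flip: a_def b_def c_def d_def) (simp add: power2_eq_square algebra_simps)
  have dense: "\<exists>s l. (\<forall>i. l $ i \<in> \<int>) \<and> dist (s *\<^sub>R e x + l) v < \<epsilon>"
    if x: "x\<^sup>2 - of_int tr * x + of_int dt = 0" and "0 < \<epsilon>" for x v \<epsilon>
  proof -
    have "(x - of_int a) / of_int b \<notin> \<rat>"
    proof
      assume "(x - of_int a) / of_int b \<in> \<rat>"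
      then have "(x - of_int a) / of_int b * of_int b + of_int a \<in> \<rat>"
        by (intro Rats_add Rats_mult) auto
      then show False using irr[OF x] b0 by simp
    qed
    then show ?thesis
      using irrational_line_dense[of "e x" \<epsilon> v] b0 \<open>0 < \<epsilon>\<close> by (simp add: e_def) metis
  qed
  have basis: "\<exists>x y. v = x *\<^sub>R e \<mu> + y *\<^sub>R e \<nu>" for v
  proof -
    define y where "y = (v $ 2 - v $ 1 / of_int b * (\<mu> - of_int a)) / (\<nu> - \<mu>)"
    define x where "x = v $ 1 / of_int b - y"
    have "x * (\<mu> - of_int a) + y * (\<nu> - of_int a) = v $ 1 / of_int b * (\<mu> - of_int a) + y * (\<nu> - \<mu>)"
      by (simp add: x_def algebra_simps)
    also have "\<dots> = v $ 2" using ne by (simp add: y_def)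
    finally have "v $ 2 = x * (\<mu> - of_int a) + y * (\<nu> - of_int a)" by simp
    moreover have "v $ 1 = x * of_int b + y * of_int b"
      using b0 by (simp add: x_def algebra_simps)
    ultimately have "v = x *\<^sub>R e \<mu> + y *\<^sub>R e \<nu>"
      by (simp add: vec_eq_iff forall_2 e_def)
    then show ?thesis by blast
  qed
  have p1: "\<bar>\<mu> * \<nu>\<bar> = 1" using prod dt by (metis of_int_1 of_int_abs)
  then have "\<mu> \<noteq> 0" by auto
  then show ?thesis
    using that[OF less _ p1 Ae[OF root(1)] Ae[OF root(2)] basis dense[OF root(1)] dense[OF root(2)]]
    by blast
qed

section \<open>The projection from the plane to the torus\<close>

lemma torus_proj_eq_iff: "torus_proj v = torus_proj w \<longleftrightarrow> (\<forall>i. v $ i - w $ i \<in> \<int>)"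
  by (simp add: torus.abs_eq_iff lattice_rel_def)

lemma torus_proj_add_lattice: "(\<And>i. l $ i \<in> \<int>) \<Longrightarrow> torus_proj (v + l) = torus_proj v"
  by (simp add: torus_proj_eq_iff)

lemma torus_proj_surj: "\<exists>v. x = torus_proj v"
  by (metis Quotient_torus Quotient_abs_rep)

lemma toral_map_proj: "toral_map A (torus_proj v) = torus_proj (of_int_matrix A *v v)"
  by (rule toral_map.abs_eq)

text \<open>A lift of a fixed point is fixed only up to an integer vector, which the projection
  removes. Orbits can thus be lifted as displacements from one constant lift.\<close>

lemma toral_map_fixed_add:
  assumes "toral_map A (torus_proj v) = torus_proj v"
  shows "toral_map A (torus_proj (v + w)) = torus_proj (v + of_int_matrix A *v w)"
  using assms unfolding toral_map_proj torus_proj_eq_iff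
  by (simp add: matrix_vector_right_distrib algebra_simps)

lemma continuous_on_torus_proj: "continuous_on UNIV torus_proj"
  by (simp add: continuous_on_open_vimage open_torus_def)

text \<open>The full preimage of the image of \<open>N\<close> is the union of its integer
  translates.\<close>

lemma open_torus_proj_image:
  assumes "open N"
  shows "open (torus_proj ` N)"
proof -
  have "torus_proj -` torus_proj ` N = (\<Union>l\<in>{l. \<forall>i. l $ i \<in> \<int>}. (+) l ` N)"
  proof (intro equalityI subsetI)
    fix v assume "v \<in> torus_proj -` torus_proj ` N"
    then obtain w where w: "w \<in> N" "torus_proj v = torus_proj w" by auto
    then have "v = (v - w) + w" "\<forall>i. (v - w) $ i \<in> \<int>" by (auto simp: torus_proj_eq_iff)
    then show "v \<in> (\<Union>l\<in>{l. \<forall>i. l $ i \<in> \<int>}. (+) l ` N)" using w by blast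
  next
    fix v assume "v \<in> (\<Union>l\<in>{l. \<forall>i. l $ i \<in> \<int>}. (+) l ` N)"
    then obtain l w where "\<And>i. l $ i \<in> \<int>" "w \<in> N" "v = l + w" by auto
    then show "v \<in> torus_proj -` torus_proj ` N"
      using torus_proj_add_lattice[of l w] by (auto simp: add.commute)
  qed
  then show ?thesis
    unfolding open_torus_def by (simp add: assms open_UN open_translation)
qed

lemma C2_on_imp_continuous_on: "C2_on S f \<Longrightarrow> continuous_on S f"
  unfolding C2_on_def continuous_on_eq_continuous_within by (metis has_derivative_continuous)

text \<open>Continuity descends from the lift because the projection is open: product neighbourhoods
  upstairs project to neighbourhoods downstairs.\<close>

lemma C2_thick_torus_map_continuous:
  assumes "C2_thick_torus_map F"
  shows "continuous_on thick_torus F"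
proof -
  let ?S = "UNIV \<times> {0..1} :: ((real^2) \<times> real) set"
  obtain G where G: "C2_on ?S G"
    and FG: "\<And>v t. t \<in> {0..1} \<Longrightarrow> F (torus_proj v, t) = (torus_proj (fst (G (v, t))), snd (G (v, t)))"
    using assms by (auto simp: C2_thick_torus_map_def)
  define H where "H = (\<lambda>y. (torus_proj (fst (G y)), snd (G y)))"
  have "continuous_on ?S G" using G by (rule C2_on_imp_continuous_on)
  then have "continuous_on ?S H"
    unfolding H_def
    by (intro continuous_on_Pair continuous_on_snd continuous_on_fst
        continuous_on_compose2[OF continuous_on_torus_proj]) auto
  then have H: "\<exists>A. open A \<and> y \<in> A \<and> (\<forall>y'\<in>?S. y' \<in> A \<longrightarrow> H y' \<in> B)"
    if "y \<in> ?S" "open B" "H y \<in> B" for y B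
    using that unfolding continuous_on_topological by blast
  show ?thesis
    unfolding continuous_on_topological
  proof (intro ballI allI impI)
    fix y B assume y: "y \<in> thick_torus" and B: "open B" "F y \<in> B"
    obtain v where "fst y = torus_proj v" using torus_proj_surj by blast
    then obtain t where vt: "y = (torus_proj v, t)" "t \<in> {0..1}"
      using y by (cases y) (auto simp: thick_torus_def)
    then have "H (v, t) \<in> B" using B FG by (simp add: H_def)
    with H[of "(v, t)" B] vt B(1) obtain A where
      A: "open A" "(v, t) \<in> A" "\<And>y'. \<lbrakk>y' \<in> ?S; y' \<in> A\<rbrakk> \<Longrightarrow> H y' \<in> B" by auto
    then obtain N T where N: "open N" "open T" "(v, t) \<in> N \<times> T" "N \<times> T \<subseteq> A"
      by (metis open_prod_elim)
    show "\<exists>A. open A \<and> y \<in> A \<and> (\<forall>y'\<in>thick_torus. y' \<in> A \<longrightarrow> F y' \<in> B)"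
    proof (intro exI[of _ "torus_proj ` N \<times> T"] conjI ballI impI)
      show "open (torus_proj ` N \<times> T)" using N by (intro open_Times open_torus_proj_image)
      show "y \<in> torus_proj ` N \<times> T" using N vt by auto
      fix y' assume "y' \<in> thick_torus" "y' \<in> torus_proj ` N \<times> T"
      then obtain v' t' where v': "y' = (torus_proj v', t')" "v' \<in> N" "t' \<in> T" "t' \<in> {0..1}"
        by (auto simp: thick_torus_def)
      then have "H (v', t') \<in> B" using A(3)[of "(v', t')"] N(4) by auto
      then show "F y' \<in> B" using FG v' by (simp add: H_def)
    qed
  qed
qed

lemma contraction_rate_pos:
  assumes A: "anosov_matrix A"
  shows "0 < contraction_rate A"
proof -
  from theI'[OF contraction_rate_unique[OF A]] obtain \<mu> where
    \<mu>: "complex_eigenvalue A \<mu>" "cmod \<mu> = contraction_rate A"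
    unfolding contraction_rate_def by blast
  have "det A \<noteq> 0" using A by (auto simp: anosov_matrix_def invertible_def dest!: arg_cong[where f=det] simp: det_mul)
  then have "\<mu> \<noteq> 0" using \<mu>(1) by (auto simp: complex_eigenvalue_iff)
  then show ?thesis using \<mu>(2) by (metis zero_less_norm_iff)
qed

section \<open>Heteroclinic orbits\<close>

lemma tendsto_power_scaleR_zero:
  fixes u :: "'v::real_normed_vector"
  assumes "\<bar>x\<bar> < 1" "filterlim g at_top F"
  shows "((\<lambda>w. x ^ g w *\<^sub>R u) \<longlongrightarrow> 0) F"
proof -
  have "(\<lambda>n. x ^ n) \<longlonglongrightarrow> 0" using assms(1) by (intro LIMSEQ_power_zero) auto
  then have "((\<lambda>w. x ^ g w) \<longlongrightarrow> 0) F" using assms(2) by (rule filterlim_compose)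
  from tendsto_scaleR[OF this tendsto_const[of u]] show ?thesis by simp
qed

abbreviation pair_filter :: "(nat \<times> nat) filter" where
  "pair_filter \<equiv> sequentially \<times>\<^sub>F sequentially"

text \<open>A compact convex set large enough to contain every base point met below, so that the \<open>C\<^sup>2\<close> data
  are uniformly Lipschitz there.\<close>

definition cball_of_norms :: "'v \<Rightarrow> 'v \<Rightarrow> 'v \<Rightarrow> 'v \<Rightarrow> 'v \<Rightarrow> 'v \<Rightarrow> 'v::real_normed_vector set" where
  "cball_of_norms a b c d e g = cball 0 (norm a + norm b + norm c + norm d + norm e + norm g)"

text \<open>No matrix occurs here, as the estimates only use powers of the two rates; determinant 1
  or -1 makes these rates equal in modulus. \<open>meet\<close> is the intersection of the unstable
  line through \<open>p\<close> with the stable line through \<open>q\<close>.\<close>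

locale heteroclinic =
  fixes p q \<sigma>\<^sub>0 \<sigma>\<^sub>1 u\<^sub>1 u\<^sub>2 :: "'v::real_normed_vector" and \<mu> \<kappa> :: real
  assumes \<mu>: "\<mu> \<noteq> 0" "\<bar>\<mu>\<bar> < 1" and \<kappa>: "\<bar>\<kappa>\<bar> = \<bar>\<mu>\<bar>"
    and meet: "p + u\<^sub>1 = q + \<sigma>\<^sub>1"
begin

text \<open>With \<open>w = (n, m)\<close>, these are lifts of one base orbit, which starts near \<open>p + \<sigma>\<^sub>0\<close>, spends time \<open>n\<close>
  near \<open>p\<close>, passes near the heteroclinic point \<open>p + u\<^sub>1 = q + \<sigma>\<^sub>1\<close>, spends time \<open>m\<close> near \<open>q\<close> and
  ends near \<open>q + u\<^sub>2\<close>; here \<open>\<mu>\<close> is the stable eigenvalue and \<open>\<kappa>\<close> the inverse of the unstable one.\<close>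

definition orbit_p :: "nat \<times> nat \<Rightarrow> nat \<Rightarrow> 'v" where
  "orbit_p w k = p + \<mu> ^ k *\<^sub>R \<sigma>\<^sub>0 + \<kappa> ^ (fst w - k) *\<^sub>R u\<^sub>1 + \<kappa> ^ (fst w + snd w - k) *\<^sub>R u\<^sub>2"

definition orbit_q :: "nat \<times> nat \<Rightarrow> nat \<Rightarrow> 'v" where
  "orbit_q w i = q + \<mu> ^ i *\<^sub>R \<sigma>\<^sub>1 + \<mu> ^ (fst w + i) *\<^sub>R \<sigma>\<^sub>0 + \<kappa> ^ (snd w - i) *\<^sub>R u\<^sub>2"

abbreviation region :: "'v set" where
  "region \<equiv> cball_of_norms p q \<sigma>\<^sub>0 \<sigma>\<^sub>1 u\<^sub>1 u\<^sub>2"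

lemma orbit_meet: "orbit_p w (fst w) = orbit_q w 0"
  using meet by (simp add: orbit_p_def orbit_q_def add.commute add.left_commute)

lemma norm_power_le:
  assumes "\<bar>x\<bar> = \<bar>\<mu>\<bar>" "l \<le> k"
  shows "norm (x ^ k *\<^sub>R u) \<le> \<bar>\<mu>\<bar> ^ l * norm u"
proof -
  have "\<bar>\<mu>\<bar> ^ k \<le> \<bar>\<mu>\<bar> ^ l" using assms \<mu> by (intro power_decreasing) auto
  then show ?thesis using assms by (simp add: power_abs mult_right_mono)
qed

lemma norm_power_le': "\<bar>x\<bar> = \<bar>\<mu>\<bar> \<Longrightarrow> norm (x ^ k *\<^sub>R u) \<le> norm u"
  using norm_power_le[of x 0 k u] by simp

lemma norm_sum4_le:
  fixes a b c d :: 'v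
  assumes "norm a \<le> a'" "norm b \<le> b'" "norm c \<le> c'" "norm d \<le> d'"
  shows "norm (a + b + c + d) \<le> a' + b' + c' + d'"
  using assms by (intro norm_triangle_le add_mono order_trans[OF norm_triangle_ineq]) auto

lemma orbit_p_in_region: "orbit_p w k \<in> region"
proof -
  have "norm (orbit_p w k) \<le> norm p + norm \<sigma>\<^sub>0 + norm u\<^sub>1 + norm u\<^sub>2"
    unfolding orbit_p_def by (intro norm_sum4_le norm_power_le' \<kappa>) auto
  then show ?thesis
    unfolding cball_of_norms_def mem_cball_0 using norm_ge_zero[of q] norm_ge_zero[of \<sigma>\<^sub>1] by linarith
qed

lemma orbit_q_in_region: "orbit_q w k \<in> region"
proof -
  have "norm (orbit_q w k) \<le> norm q + norm \<sigma>\<^sub>1 + norm \<sigma>\<^sub>0 + norm u\<^sub>2"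
    unfolding orbit_q_def by (intro norm_sum4_le norm_power_le' \<kappa>) auto
  then show ?thesis
    unfolding cball_of_norms_def mem_cball_0 using norm_ge_zero[of p] norm_ge_zero[of u\<^sub>1] by linarith
qed

section \<open>Limits of the base orbits at a fixed time from either end\<close>

lemma filterlim_fst_minus: "filterlim (\<lambda>w. fst w - k) at_top pair_filter"
  by (rule filterlim_compose[OF filterlim_minus_const_nat_at_top filterlim_fst])

lemma filterlim_snd_minus: "filterlim (\<lambda>w. snd w - k) at_top pair_filter"
  by (rule filterlim_compose[OF filterlim_minus_const_nat_at_top filterlim_snd])

lemma orbit_p_start: "((\<lambda>w. orbit_p w k) \<longlongrightarrow> p + \<mu> ^ k *\<^sub>R \<sigma>\<^sub>0) pair_filter"
proof -
  have g: "filterlim (\<lambda>w. fst w + snd w - k) at_top pair_filter"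
    by (rule filterlim_at_top_mono[OF filterlim_fst_minus[of k]]) (auto intro!: always_eventually)
  have "((\<lambda>w. orbit_p w k) \<longlongrightarrow> p + \<mu> ^ k *\<^sub>R \<sigma>\<^sub>0 + 0 + 0) pair_filter"
    unfolding orbit_p_def
    by (intro tendsto_add tendsto_const tendsto_power_scaleR_zero filterlim_fst_minus g) (use \<mu> \<kappa> in auto)
  then show ?thesis by simp
qed

lemma orbit_p_end:
  "((\<lambda>w. orbit_p w (fst w - Suc k)) \<longlongrightarrow> p + \<kappa> ^ Suc k *\<^sub>R u\<^sub>1) pair_filter"
proof -
  have g: "filterlim (\<lambda>w. snd w + Suc k) at_top pair_filter"
    by (rule filterlim_at_top_mono[OF filterlim_snd]) (auto intro!: always_eventually)
  have "((\<lambda>w. p + \<mu> ^ (fst w - Suc k) *\<^sub>R \<sigma>\<^sub>0 + \<kappa> ^ Suc k *\<^sub>R u\<^sub>1 + \<kappa> ^ (snd w + Suc k) *\<^sub>R u\<^sub>2)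
      \<longlongrightarrow> p + 0 + \<kappa> ^ Suc k *\<^sub>R u\<^sub>1 + 0) pair_filter"
    by (intro tendsto_add tendsto_const tendsto_power_scaleR_zero filterlim_fst_minus g) (use \<mu> \<kappa> in auto)
  then have "((\<lambda>w. orbit_p w (fst w - Suc k)) \<longlongrightarrow> p + 0 + \<kappa> ^ Suc k *\<^sub>R u\<^sub>1 + 0) pair_filter"
  \<comment> \<open>The subtraction is truncated, so the exponents simplify only once
    \<open>k < fst w\<close>.\<close>
  proof (rule Lim_transform_eventually)
    have "\<forall>\<^sub>F w in pair_filter. k < fst w"
      by (rule eventually_compose_filterlim[OF eventually_gt_at_top filterlim_fst])
    then show "\<forall>\<^sub>F w in pair_filter. p + \<mu> ^ (fst w - Suc k) *\<^sub>R \<sigma>\<^sub>0 + \<kappa> ^ Suc k *\<^sub>R u\<^sub>1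
        + \<kappa> ^ (snd w + Suc k) *\<^sub>R u\<^sub>2 = orbit_p w (fst w - Suc k)"
    proof eventually_elim
      case (elim w)
      then have "fst w - (fst w - Suc k) = Suc k" "fst w + snd w - (fst w - Suc k) = snd w + Suc k"
        by auto
      then show ?case by (simp only: orbit_p_def)
    qed
  qed
  then show ?thesis by simp
qed

lemma orbit_q_start: "((\<lambda>w. orbit_q w k) \<longlongrightarrow> q + \<mu> ^ k *\<^sub>R \<sigma>\<^sub>1) pair_filter"
proof -
  have g: "filterlim (\<lambda>w. fst w + k) at_top pair_filter"
    by (rule filterlim_at_top_mono[OF filterlim_fst]) (auto intro!: always_eventually)
  have "((\<lambda>w. orbit_q w k) \<longlongrightarrow> q + \<mu> ^ k *\<^sub>R \<sigma>\<^sub>1 + 0 + 0) pair_filter"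
    unfolding orbit_q_def
    by (intro tendsto_add tendsto_const tendsto_power_scaleR_zero filterlim_snd_minus g) (use \<mu> \<kappa> in auto)
  then show ?thesis by simp
qed

lemma orbit_q_end: "((\<lambda>w. orbit_q w (snd w - k)) \<longlongrightarrow> q + \<kappa> ^ k *\<^sub>R u\<^sub>2) pair_filter"
proof -
  have g: "filterlim (\<lambda>w. fst w + (snd w - k)) at_top pair_filter"
    by (rule filterlim_at_top_mono[OF filterlim_fst]) (auto intro!: always_eventually)
  have "((\<lambda>w. q + \<mu> ^ (snd w - k) *\<^sub>R \<sigma>\<^sub>1 + \<mu> ^ (fst w + (snd w - k)) *\<^sub>R \<sigma>\<^sub>0 + \<kappa> ^ k *\<^sub>R u\<^sub>2)
      \<longlongrightarrow> q + 0 + 0 + \<kappa> ^ k *\<^sub>R u\<^sub>2) pair_filter"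
    by (intro tendsto_add tendsto_const tendsto_power_scaleR_zero filterlim_snd_minus g) (use \<mu> in auto)
  then have "((\<lambda>w. orbit_q w (snd w - k)) \<longlongrightarrow> q + 0 + 0 + \<kappa> ^ k *\<^sub>R u\<^sub>2) pair_filter"
  proof (rule Lim_transform_eventually)
    have "\<forall>\<^sub>F w in pair_filter. k < snd w"
      by (rule eventually_compose_filterlim[OF eventually_gt_at_top filterlim_snd])
    then show "\<forall>\<^sub>F w in pair_filter. q + \<mu> ^ (snd w - k) *\<^sub>R \<sigma>\<^sub>1 + \<mu> ^ (fst w + (snd w - k)) *\<^sub>R \<sigma>\<^sub>0
        + \<kappa> ^ k *\<^sub>R u\<^sub>2 = orbit_q w (snd w - k)"
      by eventually_elim (simp add: orbit_q_def)
  qed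
  then show ?thesis by simp
qed

lemma orbit_p_dist:
  assumes "k < fst w"
  shows "dist (orbit_p w k) p
    \<le> (norm \<sigma>\<^sub>0 + norm u\<^sub>1 + norm u\<^sub>2) * (\<bar>\<mu>\<bar> ^ k + \<bar>\<mu>\<bar> ^ (fst w - Suc k))"
proof -
  let ?a = "\<bar>\<mu>\<bar> ^ k" and ?b = "\<bar>\<mu>\<bar> ^ (fst w - Suc k)"
  have "norm (0 + \<mu> ^ k *\<^sub>R \<sigma>\<^sub>0 + \<kappa> ^ (fst w - k) *\<^sub>R u\<^sub>1 + \<kappa> ^ (fst w + snd w - k) *\<^sub>R u\<^sub>2)
      \<le> 0 + ?a * norm \<sigma>\<^sub>0 + ?b * norm u\<^sub>1 + ?b * norm u\<^sub>2"
    using assms by (intro norm_sum4_le norm_power_le \<kappa>) auto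
  also have "\<dots> \<le> 0 + (?a + ?b) * norm \<sigma>\<^sub>0 + (?a + ?b) * norm u\<^sub>1 + (?a + ?b) * norm u\<^sub>2"
    by (intro add_mono mult_right_mono) auto
  finally show ?thesis by (simp add: orbit_p_def dist_norm algebra_simps)
qed

text \<open>Indexed from the end because this passage is run backwards; the unstable displacement
  now decays from the start of the count and the stable ones from its end.\<close>

lemma orbit_q_dist:
  assumes "i < snd w"
  shows "dist (orbit_q w (snd w - Suc i)) q
    \<le> (norm \<sigma>\<^sub>1 + norm \<sigma>\<^sub>0 + norm u\<^sub>2) * (\<bar>\<mu>\<bar> ^ i + \<bar>\<mu>\<bar> ^ (snd w - Suc i))"
proof -
  let ?a = "\<bar>\<mu>\<bar> ^ i" and ?b = "\<bar>\<mu>\<bar> ^ (snd w - Suc i)" and ?i = "snd w - Suc i"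
  have "norm (0 + \<mu> ^ ?i *\<^sub>R \<sigma>\<^sub>1 + \<mu> ^ (fst w + ?i) *\<^sub>R \<sigma>\<^sub>0 + \<kappa> ^ (snd w - ?i) *\<^sub>R u\<^sub>2)
      \<le> 0 + ?b * norm \<sigma>\<^sub>1 + ?b * norm \<sigma>\<^sub>0 + ?a * norm u\<^sub>2"
    using assms by (intro norm_sum4_le norm_power_le \<kappa>) auto
  also have "\<dots> \<le> 0 + (?a + ?b) * norm \<sigma>\<^sub>1 + (?a + ?b) * norm \<sigma>\<^sub>0 + (?a + ?b) * norm u\<^sub>2"
    by (intro add_mono mult_right_mono) auto
  finally show ?thesis by (simp add: orbit_q_def dist_norm algebra_simps)
qed

end

locale heteroclinic_fibres =
  heteroclinic p q \<sigma>\<^sub>0 \<sigma>\<^sub>1 u\<^sub>1 u\<^sub>2 \<mu> \<kappa> + fibre_family f D "cball_of_norms p q \<sigma>\<^sub>0 \<sigma>\<^sub>1 u\<^sub>1 u\<^sub>2" L lam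
  for p q \<sigma>\<^sub>0 \<sigma>\<^sub>1 u\<^sub>1 u\<^sub>2 :: "'v::real_normed_vector" and \<mu> \<kappa> :: real
    and f D :: "'v \<Rightarrow> real \<Rightarrow> real" and L lam :: real +
  assumes Dp: "D p 0 < 1" "1 < D p 1" and fp: "\<And>t. t \<in> {0<..<1} \<Longrightarrow> f p t < t"
    and Dq: "1 < D q 0" "D q 1 < 1" and fq: "\<And>t. t \<in> {0<..<1} \<Longrightarrow> t < f q t"
    and irr: "ln (D p 0) / ln (D q 0) \<notin> \<rat>"
begin

lemma endpoints_in_region: "p \<in> region" "q \<in> region" "p + \<mu> ^ k *\<^sub>R \<sigma>\<^sub>0 \<in> region" "p + \<kappa> ^ k *\<^sub>R u\<^sub>1 \<in> region"
    "q + \<mu> ^ k *\<^sub>R \<sigma>\<^sub>1 \<in> region" "q + \<kappa> ^ k *\<^sub>R u\<^sub>2 \<in> region"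
proof -
  have *: "norm (x + y ^ k *\<^sub>R u) \<le> norm x + norm u" if "\<bar>y\<bar> = \<bar>\<mu>\<bar>" for x u y
    using norm_power_le'[OF that, of k u] by (intro norm_triangle_le) simp
  note nn = norm_ge_zero[of p] norm_ge_zero[of q] norm_ge_zero[of \<sigma>\<^sub>0] norm_ge_zero[of \<sigma>\<^sub>1]
    norm_ge_zero[of u\<^sub>1] norm_ge_zero[of u\<^sub>2]
  show "p \<in> region" "q \<in> region" unfolding cball_of_norms_def mem_cball_0 using nn by linarith+
  show "p + \<mu> ^ k *\<^sub>R \<sigma>\<^sub>0 \<in> region" "p + \<kappa> ^ k *\<^sub>R u\<^sub>1 \<in> region"
    "q + \<mu> ^ k *\<^sub>R \<sigma>\<^sub>1 \<in> region" "q + \<kappa> ^ k *\<^sub>R u\<^sub>2 \<in> region"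
    unfolding cball_of_norms_def mem_cball_0
    using nn *[OF refl, of p \<sigma>\<^sub>0] *[OF \<kappa>, of p u\<^sub>1] *[OF refl, of q \<sigma>\<^sub>1] *[OF \<kappa>, of q u\<^sub>2]
    by linarith+
qed

text \<open>One constant that dominates the Lipschitz constants of \<open>log_slope\<close>, of
  \<open>log_slope_inv\<close> and of the logit gain, as \<open>fibre_passage\<close> uses a single
  one.\<close>

definition lip :: real where "lip = 2 * (L / lam) * (1 + (1 + L) / lam)"

lemma lip_ge: "0 \<le> lip" "2 * (L / lam) \<le> lip" "L / lam \<le> lip" "L / lam * (1 + (1 + L) / lam) \<le> lip"
proof -
  have "0 \<le> L / lam" "0 \<le> (1 + L) / lam" using L lam by auto
  moreover have "2 * (L / lam) * (1 + 0) \<le> lip"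
    unfolding lip_def using calculation by (intro mult_left_mono) auto
  ultimately show "2 * (L / lam) \<le> lip" "0 \<le> lip" "L / lam \<le> lip" by auto
  have "1 * (L / lam * (1 + (1 + L) / lam)) \<le> 2 * (L / lam * (1 + (1 + L) / lam))"
    using \<open>0 \<le> L / lam\<close> \<open>0 \<le> (1 + L) / lam\<close> by (intro mult_right_mono mult_nonneg_nonneg) auto
  then show "L / lam * (1 + (1 + L) / lam) \<le> lip" by (simp add: lip_def)
qed

section \<open>Fibre coordinates along the two passages\<close>

primrec down :: "real \<Rightarrow> nat \<times> nat \<Rightarrow> nat \<Rightarrow> real" where
  "down t w 0 = t"
| "down t w (Suc k) = f (orbit_p w k) (down t w k)"

text \<open>Index \<open>j\<close> counts steps back from the end of the passage near
  \<open>q\<close>, where the height is \<open>t\<close>; at \<open>j = snd w\<close> it gives the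
  height required at the crossing.\<close>

primrec up_rev :: "real \<Rightarrow> nat \<times> nat \<Rightarrow> nat \<Rightarrow> real" where
  "up_rev t w 0 = t"
| "up_rev t w (Suc j) = finv (orbit_q w (snd w - Suc j)) (up_rev t w j)"

lemma down_range: "t \<in> {0<..<1} \<Longrightarrow> down t w k \<in> {0<..<1}"
  by (induction k) (auto simp del: greaterThanLessThan_iff intro: range orbit_p_in_region)

lemma up_rev_range: "t \<in> {0<..<1} \<Longrightarrow> up_rev t w k \<in> {0<..<1}"
  by (induction k) (auto simp del: greaterThanLessThan_iff intro: finv_open orbit_q_in_region)

lemma down_asymptotics:
  assumes t: "t \<in> {0<..<1}"
  obtains S where "((\<lambda>w. ln (down t w (fst w)) - fst w * ln (D p 0)) \<longlongrightarrow> S) pair_filter"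
proof -
  obtain c where c: "0 < c" "\<And>v s. \<lbrakk>v \<in> region; s \<in> {0<..<1}\<rbrakk> \<Longrightarrow>
      1 * logit_gain v s \<le> - c + 2 * (L / lam) * dist v p"
    using Dp D_ge[of p 0] endpoints_in_region(1) lam fp
    by (elim logit_gain_bound[of p 1, rotated -1]) auto
  have "log_slope p 0 = ln (D p 0)" by (simp add: log_slope_def slope_def)
  moreover obtain B S where "((\<lambda>w. ln (down t w (fst w)) - fst w * log_slope p 0) \<longlongrightarrow> S) pair_filter"
  proof (rule fibre_passage[of pair_filter fst "\<bar>\<mu>\<bar>" "norm \<sigma>\<^sub>0 + norm u\<^sub>1 + norm u\<^sub>2" lip c region log_slope
        orbit_p p "\<lambda>k. p + \<mu> ^ k *\<^sub>R \<sigma>\<^sub>0" "\<lambda>k. p + \<kappa> ^ Suc k *\<^sub>R u\<^sub>1" "down t" t])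
    fix v v' s s' assume "v \<in> region" "v' \<in> region" "s \<in> {0..1::real}" "s' \<in> {0..1::real}"
    from log_slope_lipschitz[OF this]
    show "\<bar>log_slope v s - log_slope v' s'\<bar> \<le> lip * (dist v v' + \<bar>s - s'\<bar>)"
      using mult_right_mono[OF lip_ge(3), of "dist v v' + \<bar>s - s'\<bar>"] by simp
  next
    fix w :: "nat \<times> nat" and k :: nat
    have r: "down t w k \<in> {0<..<1}" by (rule down_range[OF t])
    then show "down t w (Suc k) = down t w k * exp (log_slope (orbit_p w k) (down t w k))"
      using f_eq[OF orbit_p_in_region, of "down t w k"] by simp
    show "ln (down t w (Suc k) / (1 - down t w (Suc k)))
        \<le> ln (down t w k / (1 - down t w k)) - c + lip * dist (orbit_p w k) p"
      using c(2)[OF orbit_p_in_region r, of w k] mult_right_mono[OF lip_ge(2), of "dist (orbit_p w k) p"]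
      by (simp add: logit_gain_def)
  next
    show "pair_filter \<noteq> bot" by (simp add: prod_filter_eq_bot)
    show "0 < \<bar>\<mu>\<bar>" "\<bar>\<mu>\<bar> < 1" using \<mu> by auto
    show "down t w k \<in> {0<..<1}" for w k by (rule down_range[OF t])
  qed (simp_all only: c lip_ge endpoints_in_region orbit_p_in_region orbit_p_dist orbit_p_start
      orbit_p_end filterlim_fst down.simps norm_ge_zero add_nonneg_nonneg)
  ultimately show ?thesis using that by simp
qed

text \<open>An instance of \<open>fibre_passage\<close> for the inverse maps. Over \<open>q\<close>
  the logit rises forwards, hence falls backwards, which explains the sign -1 in the use of
  \<open>logit_gain_bound\<close>. The decay of the heights is kept in the conclusion because it
  later bounds the distortion.\<close>

lemma up_rev_asymptotics:
  assumes t: "t \<in> {0<..<1}"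
  obtains c B S where "0 < c" "\<And>w k. k \<le> snd w \<Longrightarrow> up_rev t w k \<le> B * exp (- c) ^ k"
    "((\<lambda>w. ln (up_rev t w (snd w)) + snd w * ln (D q 0)) \<longlongrightarrow> S) pair_filter"
proof -
  obtain c where c: "0 < c" "\<And>v s. \<lbrakk>v \<in> region; s \<in> {0<..<1}\<rbrakk> \<Longrightarrow>
      (-1) * logit_gain v s \<le> - c + 2 * (L / lam) * dist v q"
    using Dq D_ge[of q 1] endpoints_in_region(2) lam fq
    by (elim logit_gain_bound[of q "-1", rotated -1]) auto
  let ?z = "\<lambda>w j. orbit_q w (snd w - Suc j)"
  have "finv q 0 = 0"
    using finv[OF endpoints_in_region(2), of 0] increasing[OF endpoints_in_region(2), of 0 "finv q 0"] lam
      f0[OF endpoints_in_region(2)] by (auto simp: mult_le_0_iff)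
  then have "log_slope_inv q 0 = - ln (D q 0)"
    by (simp add: log_slope_inv_def log_slope_def slope_def)
  moreover obtain B S where "\<And>w k. k \<le> snd w \<Longrightarrow> up_rev t w k \<le> B * exp (- c) ^ k"
    "((\<lambda>w. ln (up_rev t w (snd w)) - snd w * log_slope_inv q 0) \<longlongrightarrow> S) pair_filter"
  proof (rule fibre_passage[of pair_filter snd "\<bar>\<mu>\<bar>" "norm \<sigma>\<^sub>1 + norm \<sigma>\<^sub>0 + norm u\<^sub>2" lip c region log_slope_inv
        ?z q "\<lambda>k. q + \<kappa> ^ Suc k *\<^sub>R u\<^sub>2" "\<lambda>k. q + \<mu> ^ k *\<^sub>R \<sigma>\<^sub>1" "up_rev t" t])
    fix v v' s s' assume "v \<in> region" "v' \<in> region" "s \<in> {0..1::real}" "s' \<in> {0..1::real}"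
    from log_slope_inv_lipschitz[OF this]
    show "\<bar>log_slope_inv v s - log_slope_inv v' s'\<bar> \<le> lip * (dist v v' + \<bar>s - s'\<bar>)"
      using mult_right_mono[OF lip_ge(4), of "dist v v' + \<bar>s - s'\<bar>"] by simp
  next
    fix w :: "nat \<times> nat" and k :: nat
    have r: "up_rev t w k \<in> {0<..<1}" and r': "up_rev t w (Suc k) \<in> {0<..<1}"
      by (rule up_rev_range[OF t])+
    then show "up_rev t w (Suc k) = up_rev t w k * exp (log_slope_inv (?z w k) (up_rev t w k))"
      using finv_eq[OF orbit_q_in_region, of "up_rev t w k"] by simp
    have "f (?z w k) (up_rev t w (Suc k)) = up_rev t w k"
      using finv(2)[OF orbit_q_in_region, of "up_rev t w k"] r by simp
    then show "ln (up_rev t w (Suc k) / (1 - up_rev t w (Suc k)))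
        \<le> ln (up_rev t w k / (1 - up_rev t w k)) - c + lip * dist (?z w k) q"
      using c(2)[OF orbit_q_in_region r', of w "snd w - Suc k"]
        mult_right_mono[OF lip_ge(2), of "dist (?z w k) q"]
      by (simp add: logit_gain_def del: up_rev.simps)
  next
    fix k
    show "((\<lambda>w. ?z w (snd w - Suc k)) \<longlongrightarrow> q + \<mu> ^ k *\<^sub>R \<sigma>\<^sub>1) pair_filter"
    \<comment> \<open>Reversing the index twice gives back the forward time \<open>k\<close>,
      provided that \<open>k < snd w\<close>.\<close>
    proof (rule Lim_transform_eventually[OF orbit_q_start])
      have "\<forall>\<^sub>F w in pair_filter. k < snd w"
        by (rule eventually_compose_filterlim[OF eventually_gt_at_top filterlim_snd])
      then show "\<forall>\<^sub>F w in pair_filter. orbit_q w k = ?z w (snd w - Suc k)"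
        by eventually_elim (simp add: Suc_diff_Suc)
    qed
  next
    show "pair_filter \<noteq> bot" by (simp add: prod_filter_eq_bot)
    show "0 < \<bar>\<mu>\<bar>" "\<bar>\<mu>\<bar> < 1" using \<mu> by auto
    show "up_rev t w k \<in> {0<..<1}" for w k by (rule up_rev_range[OF t])
    fix B S assume "\<And>w k. k \<le> snd w \<Longrightarrow> up_rev t w k \<le> B * exp (- c) ^ k"
      "((\<lambda>w. ln (up_rev t w (snd w)) - snd w * log_slope_inv q 0) \<longlongrightarrow> S) pair_filter"
    then show thesis by (rule that)
  qed (simp_all only: c lip_ge endpoints_in_region orbit_q_in_region orbit_q_dist orbit_q_end
      filterlim_snd up_rev.simps norm_ge_zero add_nonneg_nonneg)
  ultimately show ?thesis using that[OF c(1), of B S] by simp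
qed

primrec up :: "real \<Rightarrow> nat \<times> nat \<Rightarrow> nat \<Rightarrow> real" where
  "up t w 0 = t"
| "up t w (Suc i) = f (orbit_q w i) (up t w i)"

lemma up_range: "t \<in> {0<..<1} \<Longrightarrow> up t w k \<in> {0<..<1}"
  by (induction k) (auto simp del: greaterThanLessThan_iff intro: range orbit_q_in_region)

text \<open>\<open>P\<close> will express that the base orbit starts and ends where it should; as it
  holds eventually, one pair of waiting times serves base and fibre together.\<close>

lemma transition:
  assumes s: "s \<in> {0<..<1}" and t: "t \<in> {0<..<1}" and \<epsilon>: "0 < \<epsilon>"
    and P: "eventually P pair_filter"
  obtains w where "P w" "0 < fst w" "\<bar>up (down s w (fst w)) w (snd w) - t\<bar> < \<epsilon>"
proof -
  obtain S\<^sub>1 where S1: "((\<lambda>w. ln (down s w (fst w)) - fst w * ln (D p 0)) \<longlongrightarrow> S\<^sub>1) pair_filter"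
    using down_asymptotics[OF s] .
  obtain c B S\<^sub>2 where c: "0 < c" and B: "\<And>w k. k \<le> snd w \<Longrightarrow> up_rev t w k \<le> B * exp (- c) ^ k"
    and S2: "((\<lambda>w. ln (up_rev t w (snd w)) + snd w * ln (D q 0)) \<longlongrightarrow> S\<^sub>2) pair_filter"
    by (rule up_rev_asymptotics[OF t]) (rule that)
  define E where "E = exp (2 * lip * B / (1 - exp (- c)))"
  have E: "E > 0" by (simp add: E_def)
  have B0: "0 \<le> B" using B[of 0 "(0, 0)"] t by simp
  \<comment> \<open>The bound \<open>1 / E\<close> admits the distortion estimate and the other one
    keeps the final error below \<epsilon>. The three parts of size \<open>\<eta> / 3\<close> are
    the errors of the two asymptotics and of the arithmetic matching.\<close>
  define \<eta> where "\<eta> = min (1 / E) (\<epsilon> / (2 * E))"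
  have \<eta>: "0 < \<eta>" "\<eta> \<le> 1 / E" "E * \<eta> < \<epsilon>"
  proof -
    show "0 < \<eta>" "\<eta> \<le> 1 / E" using E \<epsilon> by (auto simp: \<eta>_def)
    have "E * \<eta> \<le> E * (\<epsilon> / (2 * E))" using E by (intro mult_left_mono) (auto simp: \<eta>_def)
    also have "\<dots> < \<epsilon>" using E \<epsilon> by simp
    finally show "E * \<eta> < \<epsilon>" .
  qed
  have "\<forall>\<^sub>F w in pair_filter. P w \<and>
      \<bar>ln (down s w (fst w)) - fst w * ln (D p 0) - S\<^sub>1\<bar> < \<eta> / 3 \<and>
      \<bar>ln (up_rev t w (snd w)) + snd w * ln (D q 0) - S\<^sub>2\<bar> < \<eta> / 3"
    using P tendstoD[OF S1, of "\<eta> / 3"] tendstoD[OF S2, of "\<eta> / 3"] \<eta>(1)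
    by (auto simp: dist_real_def intro!: eventually_conj)
  then obtain N where N: "\<And>n m. \<lbrakk>n \<ge> N; m \<ge> N\<rbrakk> \<Longrightarrow> P (n, m) \<and>
      \<bar>ln (down s (n, m) n) - n * ln (D p 0) - S\<^sub>1\<bar> < \<eta> / 3 \<and>
      \<bar>ln (up_rev t (n, m) m) + m * ln (D q 0) - S\<^sub>2\<bar> < \<eta> / 3"
    unfolding eventually_prod_sequentially by auto
  have "ln (D p 0) < 0" "0 < ln (D q 0)" "0 < \<eta> / 3"
    using Dp Dq D_ge[of p 0] endpoints_in_region(1) lam \<eta> by auto
  \<comment> \<open>\<open>Suc N\<close> instead of \<open>N\<close> makes \<open>n\<close>
    positive, as needed for a positive number of iterates.\<close>
  from dense_natural_combinations[OF irr this, of "Suc N" "S\<^sub>2 - S\<^sub>1"]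
  obtain n m where nm: "n \<ge> Suc N" "m \<ge> Suc N"
      "\<bar>n * ln (D p 0) + m * ln (D q 0) - (S\<^sub>2 - S\<^sub>1)\<bar> < \<eta> / 3" by blast
  define w where "w = (n, m)"
  define x where "x = down s w n"
  have x: "x \<in> {0<..<1}" unfolding x_def by (rule down_range[OF s])
  have close: "\<bar>ln (up x w (m - m)) - ln (up_rev t w m)\<bar> < \<eta>"
  proof -
    have "\<bar>ln x - n * ln (D p 0) - S\<^sub>1\<bar> < \<eta> / 3" "\<bar>ln (up_rev t w m) + m * ln (D q 0) - S\<^sub>2\<bar> < \<eta> / 3"
      using N[of n m] nm by (auto simp: w_def x_def)
    then have "\<bar>ln x - ln (up_rev t w m)\<bar> < \<eta>" using nm(3) by linarith
    then show ?thesis by simp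
  qed
  \<comment> \<open>The forward orbit is read backwards as \<open>\<lambda>j. up x w (m - j)\<close>
    to be compared with \<open>up_rev\<close>; hence the unsimplified indices.\<close>
  have "\<bar>ln (up x w (m - 0)) - ln (up_rev t w 0)\<bar> \<le> E * \<bar>ln (up x w (m - m)) - ln (up_rev t w m)\<bar>"
  proof (rule log_distance_gronwall[where \<gamma> = "\<lambda>j. log_slope (orbit_q w (m - Suc j))"
        and L = lip and B = B and \<rho> = "exp (- c)"])
    show "0 < up x w (m - j) \<and> up x w (m - j) \<le> 1" for j
      using up_range[OF x, of w "m - j"] by auto
    show "0 < up_rev t w j \<and> up_rev t w j \<le> 1" for j
      using up_rev_range[OF t, of w j] by auto
    show "up x w (m - j) = up x w (m - Suc j) * exp (log_slope (orbit_q w (m - Suc j)) (up x w (m - Suc j)))"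
      if "j < m" for j
    proof -
      have "m - j = Suc (m - Suc j)" using that by simp
      then show ?thesis
        using f_eq[OF orbit_q_in_region, of "up x w (m - Suc j)" w] up_range[OF x, of w "m - Suc j"] by simp
    qed
    show "up_rev t w j = up_rev t w (Suc j) * exp (log_slope (orbit_q w (m - Suc j)) (up_rev t w (Suc j)))"
      if "j < m" for j
    proof -
      have "f (orbit_q w (m - Suc j)) (up_rev t w (Suc j)) = up_rev t w j"
        using finv(2)[OF orbit_q_in_region, of "up_rev t w j"] up_rev_range[OF t, of w j] by (simp add: w_def)
      then show ?thesis
        using f_eq[OF orbit_q_in_region, of "up_rev t w (Suc j)" w "m - Suc j"] up_rev_range[OF t, of w "Suc j"]
        by (simp del: up_rev.simps)
    qed
    show "\<bar>log_slope (orbit_q w (m - Suc j)) x - log_slope (orbit_q w (m - Suc j)) y\<bar> \<le> lip * \<bar>x - y\<bar>"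
      if "x \<in> {0..1}" "y \<in> {0..1}" for j x y
      using log_slope_lipschitz[OF orbit_q_in_region orbit_q_in_region that, of w "m - Suc j" w "m - Suc j"]
        mult_right_mono[OF lip_ge(3), of "\<bar>x - y\<bar>"] by simp
    show "up_rev t w j \<le> B * exp (- c) ^ j" if "j \<le> m" for j
      using B[of j w] that by (simp add: w_def)
    show "\<bar>ln (up x w (m - m)) - ln (up_rev t w m)\<bar> \<le> 1 / E" using close \<eta> by linarith
  qed (use lip_ge B0 c E_def in auto)
  also have "\<dots> \<le> E * \<eta>" using close E by (intro mult_left_mono) auto
  finally have "\<bar>ln (up x w m) - ln t\<bar> < \<epsilon>" using \<eta> by simp
  then have "\<bar>up x w m - t\<bar> < \<epsilon>"
    using abs_diff_le_abs_ln_diff[OF up_range[OF x, of w m] t] by linarith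
  then show ?thesis using that[of w] N[of n m] nm by (auto simp: w_def x_def)
qed

end

section \<open>Transitivity\<close>

text \<open>The quotient affects only the base, so the second component of a lift is the fibre map
  itself and the fibre derivative is a partial derivative of the lift.\<close>

lemma kan_type_fibre_derivative:
  assumes kan: "kan_type F A \<phi> p q"
  obtains D where
    "\<And>v t. t \<in> {0..1} \<Longrightarrow> (\<phi> (torus_proj v) has_real_derivative D v t) (at t within {0..1})"
    "\<And>v t. t \<in> {0..1} \<Longrightarrow> fibre_deriv (\<phi> (torus_proj v)) t = D v t"
    "\<And>K. \<lbrakk>compact K; convex K\<rbrakk> \<Longrightarrow> \<exists>L\<ge>0. \<forall>v\<in>K. \<forall>w\<in>K. \<forall>t\<in>{0..1}. \<forall>s\<in>{0..1}.
        \<bar>D v t - D w s\<bar> \<le> L * (dist v w + \<bar>t - s\<bar>)"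
proof -
  obtain G where G: "C2_on (UNIV \<times> {0..1}) G"
    and FG: "\<And>v t. t \<in> {0..1} \<Longrightarrow> F (torus_proj v, t) = (torus_proj (fst (G (v, t))), snd (G (v, t)))"
    using kan by (auto simp: kan_type_def C2_thick_torus_map_def)
  obtain D where der: "\<And>v t. t \<in> {0..1} \<Longrightarrow>
      ((\<lambda>t. snd (G (v, t))) has_real_derivative D v t) (at t within {0..1})"
    and lip: "\<And>K. \<lbrakk>compact K; convex K\<rbrakk> \<Longrightarrow> \<exists>L\<ge>0. \<forall>v\<in>K. \<forall>w\<in>K. \<forall>t\<in>{0..1}. \<forall>s\<in>{0..1}.
        \<bar>D v t - D w s\<bar> \<le> L * (dist v w + \<bar>t - s\<bar>)"
    by (rule C2_on_partial_derivative[OF G]) (rule that)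
  have eq: "snd (G (v, t)) = \<phi> (torus_proj v) t" if "t \<in> {0..1}" for v t
    using kan FG[OF that, of v] that by (simp add: kan_type_def)
  have der': "(\<phi> (torus_proj v) has_real_derivative D v t) (at t within {0..1})" if "t \<in> {0..1}" for v t
    by (rule has_field_derivative_transform_within[OF der[OF that], where d = 1]) (use that eq in auto)
  have fibre_D: "fibre_deriv (\<phi> (torus_proj v)) t = D v t" if "t \<in> {0..1}" for v t
  proof -
    have "(\<phi> (torus_proj v) has_vector_derivative D v t) (at t within cbox 0 1)"
      using der'[OF that] by (simp add: has_real_derivative_iff_has_vector_derivative)
    from vector_derivative_within_cbox[OF _ _ this] show ?thesis using that by simp
  qed
  show ?thesis
    by (rule that[of D]) (rule der' fibre_D lip; assumption)+
qed

lemma skew_product_orbit: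
  assumes F: "\<And>x t. t \<in> {0..1} \<Longrightarrow> F (x, t) = (T x, \<phi> x t)"
    and T: "\<And>k. k < N \<Longrightarrow> T (x k) = x (Suc k)"
    and \<tau>: "\<And>k. k < N \<Longrightarrow> \<tau> (Suc k) = \<phi> (x k) (\<tau> k)" "\<And>k. k < N \<Longrightarrow> \<tau> k \<in> {0..1}"
    and k: "k \<le> N"
  shows "(F ^^ k) (x 0, \<tau> 0) = (x k, \<tau> k)"
  using k
proof (induction k)
  case (Suc k)
  then have "k < N" by simp
  with Suc show ?case using F[OF \<tau>(2), of k "x k"] T \<tau>(1) by simp
qed simp

lemma openin_thick_torus_contains_box:
  assumes U: "openin (top_of_set thick_torus) U" "U \<noteq> {}"
  obtains v t \<epsilon> where "0 < \<epsilon>" "t \<in> {0<..<1}"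
    "\<And>w s. \<lbrakk>dist w v < \<epsilon>; \<bar>s - t\<bar> < \<epsilon>; s \<in> {0..1}\<rbrakk> \<Longrightarrow> (torus_proj w, s) \<in> U"
proof -
  obtain W where W: "open W" "U = thick_torus \<inter> W"
    using U(1) by (auto simp: openin_open)
  obtain x t\<^sub>0 where "(x, t\<^sub>0) \<in> U" using U(2) by auto
  then have xt: "(x, t\<^sub>0) \<in> W" "t\<^sub>0 \<in> {0..1}" using W by (auto simp: thick_torus_def)
  then obtain X T where XT: "open X" "open T" "x \<in> X" "t\<^sub>0 \<in> T" "X \<times> T \<subseteq> W"
    using W(1) by (metis open_prod_elim mem_Sigma_iff)
  \<comment> \<open>The given point may lie on an invariant boundary torus, where the logit is
    useless; an interior height nearby replaces it.\<close>
  have "t\<^sub>0 \<in> closure {0<..<1}" using xt by simp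
  then have "T \<inter> {0<..<1} \<noteq> {}"
    using XT open_Int_closure_eq_empty[of T "{0<..<1}"] by blast
  then obtain t where t: "t \<in> T" "t \<in> {0<..<1}" by blast
  obtain v where v: "x = torus_proj v" using torus_proj_surj by blast
  have "open (torus_proj -` X)" using XT(1) by (simp add: open_torus_def)
  then obtain d where d: "0 < d" "\<And>w. dist w v < d \<Longrightarrow> torus_proj w \<in> X"
    using XT(3) v unfolding open_dist by auto
  obtain e where e: "0 < e" "\<And>s. \<bar>s - t\<bar> < e \<Longrightarrow> s \<in> T"
    using XT(2) t(1) unfolding open_dist dist_real_def by auto
  show ?thesis
    using d e t XT(5) by (intro that[of "min d e" t v]) (auto simp: W thick_torus_def)
qed

theorem theorem1:
  fixes F :: "torus \<times> real \<Rightarrow> torus \<times> real"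
    and A :: "int^2^2"
    and \<phi> :: "torus \<Rightarrow> real \<Rightarrow> real"
    and p q :: torus
  assumes "kan_type F A \<phi> p q"
    and "ln (fibre_deriv (\<phi> p) 0) / ln (fibre_deriv (\<phi> q) 0) \<notin> \<rat>"
  shows "topologically_transitive_on thick_torus F"
  unfolding topologically_transitive_on_def
proof (intro conjI allI impI)
  note kan = assms(1)
  have C2: "C2_thick_torus_map F" using kan by (simp add: kan_type_def)
  show "continuous_on thick_torus F" using C2 by (rule C2_thick_torus_map_continuous)
  show "F ` thick_torus \<subseteq> thick_torus" using C2 by (simp add: C2_thick_torus_map_def)
  fix U V
  assume UV: "openin (top_of_set thick_torus) U \<and> openin (top_of_set thick_torus) V \<and> U \<noteq> {} \<and> V \<noteq> {}"
  obtain v\<^sub>U s \<epsilon>\<^sub>U where U: "0 < \<epsilon>\<^sub>U" "s \<in> {0<..<1}"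
      "\<And>w r. \<lbrakk>dist w v\<^sub>U < \<epsilon>\<^sub>U; \<bar>r - s\<bar> < \<epsilon>\<^sub>U; r \<in> {0..1}\<rbrakk> \<Longrightarrow> (torus_proj w, r) \<in> U"
    using openin_thick_torus_contains_box[of U] UV by metis
  obtain v\<^sub>V t \<epsilon>\<^sub>V where V: "0 < \<epsilon>\<^sub>V" "t \<in> {0<..<1}"
      "\<And>w r. \<lbrakk>dist w v\<^sub>V < \<epsilon>\<^sub>V; \<bar>r - t\<bar> < \<epsilon>\<^sub>V; r \<in> {0..1}\<rbrakk> \<Longrightarrow> (torus_proj w, r) \<in> V"
    using openin_thick_torus_contains_box[of V] UV by metis
  have A: "anosov_matrix A" and fix_pq: "toral_map A p = p" "toral_map A q = q"
    and F: "\<And>x t. t \<in> {0..1} \<Longrightarrow> F (x, t) = (toral_map A x, \<phi> x t)"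
    and \<phi>01: "\<And>x. \<phi> x 0 = 0" "\<And>x. \<phi> x 1 = 1"
    and NS: "NS_map (\<phi> p)" and SN: "SN_map (\<phi> q)"
    and low: "\<And>x t. t \<in> {0..1} \<Longrightarrow> contraction_rate A < fibre_deriv (\<phi> x) t"
    using kan by (auto simp: kan_type_def)
  let ?A = "(*v) (of_int_matrix A :: real^2^2)"
  obtain \<mu> \<nu> :: real and e\<^sub>s e\<^sub>u :: "real^2"
    where \<mu>: "\<bar>\<mu>\<bar> < 1" "\<mu> \<noteq> 0" and \<mu>\<nu>: "\<bar>\<mu> * \<nu>\<bar> = 1"
      and Ae: "?A e\<^sub>s = \<mu> *\<^sub>R e\<^sub>s" "?A e\<^sub>u = \<nu> *\<^sub>R e\<^sub>u"
      and basis: "\<And>v. \<exists>x y. v = x *\<^sub>R e\<^sub>s + y *\<^sub>R e\<^sub>u"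
      and dense: "\<And>v \<epsilon>. 0 < \<epsilon> \<Longrightarrow> \<exists>s l. (\<forall>i. l $ i \<in> \<int>) \<and> dist (s *\<^sub>R e\<^sub>s + l) v < \<epsilon>"
        "\<And>v \<epsilon>. 0 < \<epsilon> \<Longrightarrow> \<exists>s l. (\<forall>i. l $ i \<in> \<int>) \<and> dist (s *\<^sub>R e\<^sub>u + l) v < \<epsilon>"
    by (rule anosov_matrix_eigenbasis[OF A]) (rule that)
  have A_scale: "?A (x *\<^sub>R v) = x *\<^sub>R ?A v" for x v
    by (simp add: linear_scale)
  obtain p' q' where pq: "p = torus_proj p'" "q = torus_proj q'"
    using torus_proj_surj by metis
  obtain D where der: "\<And>v t. t \<in> {0..1} \<Longrightarrow> (\<phi> (torus_proj v) has_real_derivative D v t) (at t within {0..1})"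
    and fibre_D: "\<And>v t. t \<in> {0..1} \<Longrightarrow> fibre_deriv (\<phi> (torus_proj v)) t = D v t"
    and D_lip: "\<And>K. \<lbrakk>compact K; convex K\<rbrakk> \<Longrightarrow> \<exists>L\<ge>0. \<forall>v\<in>K. \<forall>w\<in>K. \<forall>t\<in>{0..1}. \<forall>s\<in>{0..1}.
        \<bar>D v t - D w s\<bar> \<le> L * (dist v w + \<bar>t - s\<bar>)"
    by (rule kan_type_fibre_derivative[OF kan]) (rule that)
  obtain x\<^sub>0 l\<^sub>0 where x0: "\<And>i. l\<^sub>0 $ i \<in> \<int>" "dist (x\<^sub>0 *\<^sub>R e\<^sub>s + l\<^sub>0) (v\<^sub>U - p') < \<epsilon>\<^sub>U / 2"
    using dense(1)[of "\<epsilon>\<^sub>U / 2" "v\<^sub>U - p'"] U(1) by auto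
  obtain x\<^sub>2 l\<^sub>2 where x2: "\<And>i. l\<^sub>2 $ i \<in> \<int>" "dist (x\<^sub>2 *\<^sub>R e\<^sub>u + l\<^sub>2) (v\<^sub>V - q') < \<epsilon>\<^sub>V / 2"
    using dense(2)[of "\<epsilon>\<^sub>V / 2" "v\<^sub>V - q'"] V(1) by auto
  \<comment> \<open>The source of the heteroclinic point: moving the stable part to the side of
    \<open>q'\<close> gives \<open>meet\<close>.\<close>
  obtain x y where xy: "q' - p' = x *\<^sub>R e\<^sub>s + y *\<^sub>R e\<^sub>u" using basis by blast
  define \<sigma>\<^sub>0 \<sigma>\<^sub>1 u\<^sub>1 u\<^sub>2 where "\<sigma>\<^sub>0 = x\<^sub>0 *\<^sub>R e\<^sub>s" and "\<sigma>\<^sub>1 = (- x) *\<^sub>R e\<^sub>s"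
    and "u\<^sub>1 = y *\<^sub>R e\<^sub>u" and "u\<^sub>2 = x\<^sub>2 *\<^sub>R e\<^sub>u"
  have A\<sigma>: "?A \<sigma>\<^sub>0 = \<mu> *\<^sub>R \<sigma>\<^sub>0" "?A \<sigma>\<^sub>1 = \<mu> *\<^sub>R \<sigma>\<^sub>1" and Au: "?A u\<^sub>1 = \<nu> *\<^sub>R u\<^sub>1" "?A u\<^sub>2 = \<nu> *\<^sub>R u\<^sub>2"
    unfolding \<sigma>\<^sub>0_def \<sigma>\<^sub>1_def u\<^sub>1_def u\<^sub>2_def A_scale Ae by (simp_all only: scaleR_left_commute)
  have \<nu>: "\<nu> \<noteq> 0" using \<mu>\<nu> by auto
  interpret heteroclinic p' q' \<sigma>\<^sub>0 \<sigma>\<^sub>1 u\<^sub>1 u\<^sub>2 \<mu> "inverse \<nu>"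
  proof
    show "\<bar>inverse \<nu>\<bar> = \<bar>\<mu>\<bar>" using \<mu>\<nu> \<nu> by (simp add: abs_mult field_simps)
    show "p' + u\<^sub>1 = q' + \<sigma>\<^sub>1" using xy by (simp add: u\<^sub>1_def \<sigma>\<^sub>1_def algebra_simps)
  qed (use \<mu> in auto)
  have "compact region" "convex region" by (auto simp: cball_of_norms_def)
  from D_lip[OF this] obtain L where L0: "0 \<le> L" and L: "\<forall>v\<in>region. \<forall>w\<in>region. \<forall>t\<in>{0..1}. \<forall>s\<in>{0..1}.
      \<bar>D v t - D w s\<bar> \<le> L * (dist v w + \<bar>t - s\<bar>)"
    by (elim exE conjE)
  have fd: "fibre_deriv (\<phi> p) 0 = D p' 0" "fibre_deriv (\<phi> p) 1 = D p' 1"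
    "fibre_deriv (\<phi> q) 0 = D q' 0" "fibre_deriv (\<phi> q) 1 = D q' 1"
    by (simp_all add: pq fibre_D)
  interpret heteroclinic_fibres p' q' \<sigma>\<^sub>0 \<sigma>\<^sub>1 u\<^sub>1 u\<^sub>2 \<mu> "inverse \<nu>" "\<lambda>v. \<phi> (torus_proj v)" D L "contraction_rate A"
  proof
    show "contraction_rate A \<le> D v t" if "t \<in> {0..1}" for v t
      using low[OF that, of "torus_proj v"] fibre_D[OF that, of v] by simp
    show "ln (D p' 0) / ln (D q' 0) \<notin> \<rat>" using assms(2) unfolding fd .
    show "D p' 0 < 1" "1 < D p' 1" "\<And>t. t \<in> {0<..<1} \<Longrightarrow> \<phi> (torus_proj p') t < t"
      using NS unfolding NS_map_def fd by (auto simp: pq)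
    show "1 < D q' 0" "D q' 1 < 1" "\<And>t. t \<in> {0<..<1} \<Longrightarrow> t < \<phi> (torus_proj q') t"
      using SN unfolding SN_map_def fd by (auto simp: pq)
  qed (rule der \<phi>01 L0 L[rule_format] contraction_rate_pos[OF A]; assumption)+
  have shift_s: "?A (\<mu> ^ k *\<^sub>R u) = \<mu> ^ Suc k *\<^sub>R u" if "?A u = \<mu> *\<^sub>R u" for k u
    unfolding A_scale that by (simp add: mult.commute)
  \<comment> \<open>The matrix lowers the exponent of \<open>inverse \<nu>\<close>, which must
    therefore be positive; this limits the steps below to times before the end of each
    passage.\<close>
  have shift_u: "?A (inverse \<nu> ^ k *\<^sub>R u) = inverse \<nu> ^ j *\<^sub>R u"
    if "?A u = \<nu> *\<^sub>R u" "k = Suc j" for j k u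
    unfolding A_scale that using \<nu> by simp
  have step_p: "toral_map A (torus_proj (orbit_p w k)) = torus_proj (orbit_p w (Suc k))"
    if "k < fst w" for w k
  proof -
    have "?A (inverse \<nu> ^ (fst w - k) *\<^sub>R u\<^sub>1) = inverse \<nu> ^ (fst w - Suc k) *\<^sub>R u\<^sub>1"
      "?A (inverse \<nu> ^ (fst w + snd w - k) *\<^sub>R u\<^sub>2) = inverse \<nu> ^ (fst w + snd w - Suc k) *\<^sub>R u\<^sub>2"
      using that by (auto intro!: shift_u Au)
    then show ?thesis
      unfolding orbit_p_def add.assoc toral_map_fixed_add[OF fix_pq(1)[unfolded pq]]
      by (simp only: matrix_vector_right_distrib shift_s[OF A\<sigma>(1)])
  qed
  have step_q: "toral_map A (torus_proj (orbit_q w i)) = torus_proj (orbit_q w (Suc i))"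
    if "i < snd w" for w i
  proof -
    have "?A (inverse \<nu> ^ (snd w - i) *\<^sub>R u\<^sub>2) = inverse \<nu> ^ (snd w - Suc i) *\<^sub>R u\<^sub>2"
      using that by (auto intro!: shift_u Au)
    then show ?thesis
      unfolding orbit_q_def add.assoc toral_map_fixed_add[OF fix_pq(2)[unfolded pq]]
      by (simp only: matrix_vector_right_distrib shift_s[OF A\<sigma>(1)] shift_s[OF A\<sigma>(2)] add_Suc_right)
  qed
  have "\<forall>\<^sub>F w in pair_filter. dist (orbit_p w 0) (p' + \<sigma>\<^sub>0) < \<epsilon>\<^sub>U / 2 \<and> dist (orbit_q w (snd w)) (q' + u\<^sub>2) < \<epsilon>\<^sub>V / 2"
    using tendstoD[OF orbit_p_start[of 0], of "\<epsilon>\<^sub>U / 2"] tendstoD[OF orbit_q_end[of 0], of "\<epsilon>\<^sub>V / 2"] U(1) V(1)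
    by (auto intro: eventually_conj)
  from transition[OF U(2) V(2) V(1) this] obtain w where
    w: "dist (orbit_p w 0) (p' + \<sigma>\<^sub>0) < \<epsilon>\<^sub>U / 2" "dist (orbit_q w (snd w)) (q' + u\<^sub>2) < \<epsilon>\<^sub>V / 2"
      "0 < fst w" "\<bar>up (down s w (fst w)) w (snd w) - t\<bar> < \<epsilon>\<^sub>V" by blast
  let ?x = "down s w (fst w)" and ?y = "up (down s w (fst w)) w (snd w)"
  have x: "?x \<in> {0<..<1}" by (rule down_range[OF U(2)])
  have r1: "down s w k \<in> {0..1}" for k using down_range[OF U(2), of w k] by auto
  have r2: "up ?x w k \<in> {0..1}" for k using up_range[OF x, of w k] by auto
  have "(F ^^ fst w) (torus_proj (orbit_p w 0), s) = (torus_proj (orbit_p w (fst w)), ?x)"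
    using skew_product_orbit[where F = F and T = "toral_map A" and x = "\<lambda>k. torus_proj (orbit_p w k)"
        and \<tau> = "down s w" and N = "fst w" and \<phi> = \<phi>, OF F step_p _ r1 order_refl] by simp
  moreover have "(F ^^ snd w) (torus_proj (orbit_q w 0), ?x) = (torus_proj (orbit_q w (snd w)), ?y)"
    using skew_product_orbit[where F = F and T = "toral_map A" and x = "\<lambda>k. torus_proj (orbit_q w k)"
        and \<tau> = "up ?x w" and N = "snd w" and \<phi> = \<phi>, OF F step_q _ r2 order_refl] by simp
  \<comment> \<open>By \<open>orbit_meet\<close> the second passage starts exactly where the first
    one ends.\<close>
  ultimately have orbit: "(F ^^ (snd w + fst w)) (torus_proj (orbit_p w 0), s) = (torus_proj (orbit_q w (snd w)), ?y)"
    by (simp add: funpow_add orbit_meet)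
  \<comment> \<open>The integer vector brings the lifted starting point close to the chosen lift
    \<open>v\<^sub>U\<close> without changing its projection.\<close>
  have "dist (orbit_p w 0 + l\<^sub>0) v\<^sub>U < \<epsilon>\<^sub>U"
  proof -
    have "orbit_p w 0 + l\<^sub>0 - v\<^sub>U = (orbit_p w 0 - (p' + \<sigma>\<^sub>0)) + (x\<^sub>0 *\<^sub>R e\<^sub>s + l\<^sub>0 - (v\<^sub>U - p'))"
      by (simp add: \<sigma>\<^sub>0_def)
    then have "dist (orbit_p w 0 + l\<^sub>0) v\<^sub>U
        \<le> dist (orbit_p w 0) (p' + \<sigma>\<^sub>0) + dist (x\<^sub>0 *\<^sub>R e\<^sub>s + l\<^sub>0) (v\<^sub>U - p')"
      unfolding dist_norm by (simp only: norm_triangle_ineq)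
    then show ?thesis using w(1) x0(2) by linarith
  qed
  then have "(torus_proj (orbit_p w 0), s) \<in> U"
    using U(3)[of "orbit_p w 0 + l\<^sub>0" s] U(1,2) torus_proj_add_lattice[OF x0(1)] by auto
  moreover have "dist (orbit_q w (snd w) + l\<^sub>2) v\<^sub>V < \<epsilon>\<^sub>V"
  proof -
    have "orbit_q w (snd w) + l\<^sub>2 - v\<^sub>V
        = (orbit_q w (snd w) - (q' + u\<^sub>2)) + (x\<^sub>2 *\<^sub>R e\<^sub>u + l\<^sub>2 - (v\<^sub>V - q'))"
      by (simp add: u\<^sub>2_def)
    then have "dist (orbit_q w (snd w) + l\<^sub>2) v\<^sub>V
        \<le> dist (orbit_q w (snd w)) (q' + u\<^sub>2) + dist (x\<^sub>2 *\<^sub>R e\<^sub>u + l\<^sub>2) (v\<^sub>V - q')"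
      unfolding dist_norm by (simp only: norm_triangle_ineq)
    then show ?thesis using w(2) x2(2) by linarith
  qed
  then have "(torus_proj (orbit_q w (snd w)), ?y) \<in> V"
    using V(3)[of "orbit_q w (snd w) + l\<^sub>2" ?y] w(4) r2 torus_proj_add_lattice[OF x2(1)] by auto
  ultimately have "(F ^^ (snd w + fst w)) ` U \<inter> V \<noteq> {}"
    using orbit by (metis IntI empty_iff imageI)
  then show "\<exists>m>0. (F ^^ m) ` U \<inter> V \<noteq> {}" using w(3) by (intro exI[of _ "snd w + fst w"]) simp
qed

end
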